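(* Let $G=(V,E)$ be a hypergraph, let $\{w_A\}_{A\in E}$, $\{\lambda_A\}_{A\in E}$ and ${\bf t}=(t_i)_{i\in V}$ be complex numbers. Then $$\int \mathcal{D}(\psi,\bar\psi)\,\exp\Big[\sum_{i\in V} t_i\bar\psi_i\psi_i+\sum_{A\in E} w_A f_A^{(\lambda_A)}\Big]=\sum_{\substack{F\in\mathcal{F}(G)\\ F=(F_1,\ldots,F_\ell)}}\Big(\prod_{A\in F}w_A\Big)\prod_{\alpha=1}^{\ell}\Big(\sum_{i\in V(F_\alpha)}t_i-\sum_{A\in E(F_\alpha)}(|A|-1)\lambda_A\Big).$$ In particular, if $\lambda_A=\lambda$ for all $A\in E$, $$\int \mathcal{D}(\psi,\bar\psi)\,\exp\Big[\sum_{i} t_i\bar\psi_i\psi_i+\sum_{A\in E} w_A f_A^{(\lambda)}\Big]=\sum_{\substack{F\in\mathcal{F}(G)\\ F=(F_1,\ldots,F_\ell)}}\Big(\prod_{A\in F}w_A\Big)\prod_{\alpha=1}^{\ell}\Big(\lambda+\sum_{i\in V(F_\alpha)}(t_i-\lambda)\Big).$$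
   Context: A hypergraph is a pair $G=(V,E)$ with $V$ a finite set and $E$ a set (no repetitions) of subsets of $V$, each of cardinality at least 2 (hyperedges). A walk is a sequence $(v_0,e_1,v_1,\ldots,e_k,v_k)$ with $v_i\in V$, $e_i\in E$, $v_{i-1},v_i\in e_i$; $G$ is connected if any two vertices are joined by a walk; connected components are the maximal connected subhypergraphs (isolated vertices are components). A cycle is a walk with $v_0,\ldots,v_{k-1}$ distinct, $v_k=v_0$, $e_1,\ldots,e_k$ distinct, and $k\ge 2$. A hyperforest is a hypergraph with no cycles; a hypertree is a connected hyperforest. A spanning hyperforest of $G$ is a subset $F\subseteq E$ such that $(V,F)$ is a hyperforest; $\mathcal{F}(G)$ is the set of these; its components $F_1,\ldots,F_\ell$ are the connected components of $(V,F)$, with vertex sets $V(F_\alpha)$ and hyperedge sets $E(F_\alpha)$. Grassmann setting: for each $i\in V$ there are anticommuting generators $\psi_i,\bar\psi_i$ of a Grassmann algebra over $\mathbb{C}$. For $A\subseteq V$, $\tau_A=\prod_{i\in A}\bar\psi_i\psi_i$ ($\tau_\emptyset=1$), and for $\lambda\in\mathbb{C}$, $$f_A^{(\lambda)}=\lambda(1-|A|)\tau_A+\sum_{i\in A}\tau_{A\setminus\{i\}}-\sum_{i,j\in A,\ i\neq j}\bar\psi_i\psi_j\,\tau_{A\setminus\{i,j\}}.$$ Berezin integration: $\mathcal{D}(\psi,\bar\psi)=\prod_{i\in V}d\psi_i\,d\bar\psi_i$, with the convention $\int d\psi_i\,d\bar\psi_i\,\bar\psi_i\psi_i=1$ and $\int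 d\psi_i\,d\bar\psi_i\,m=0$ for monomials $m$ in $\psi_i,\bar\psi_i$ of lower degree. The exponential of an even element is defined by its (finite) power series. *)

theory Defs
  imports Complex_Main
begin

text \<open>Generators are pairs (i, b): (i, False) stands for psibar_i and (i, True) for psi_i.
  They are totally ordered by psibar_1 < psi_1 < psibar_2 < psi_2 < ...  (vertex-major order).
  An element of the Grassmann algebra is a coefficient function on finite sets of generators;
  the set U represents the monomial that is the product of the generators of U in increasing order.\<close>

type_synonym 'v gen = "'v \<times> bool"
type_synonym 'v grass = "'v gen set \<Rightarrow> complex"

definition gless :: "'v::linorder gen \<Rightarrow> 'v gen \<Rightarrow> bool" where
  "gless x y \<longleftrightarrow> fst x < fst y \<or> (fst x = fst y \<and> \<not> snd x \<and> snd y)"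

definition inv_count :: "'v::linorder gen set \<Rightarrow> 'v gen set \<Rightarrow> nat" where
  "inv_count U W = card {(x, y). x \<in> U \<and> y \<in> W \<and> gless y x}"

definition gone :: "'v grass" where
  "gone = (\<lambda>S. if S = {} then 1 else 0)"

definition gzero :: "'v grass" where
  "gzero = (\<lambda>S. 0)"

definition gadd :: "'v grass \<Rightarrow> 'v grass \<Rightarrow> 'v grass" where
  "gadd X Y = (\<lambda>S. X S + Y S)"

definition gscale :: "complex \<Rightarrow> 'v grass \<Rightarrow> 'v grass" where
  "gscale c X = (\<lambda>S. c * X S)"

definition gsum :: "('a \<Rightarrow> 'v grass) \<Rightarrow> 'a set \<Rightarrow> 'v grass" where
  "gsum f I = (\<lambda>S. \<Sum>a\<in>I. f a S)"

text \<open>Grassmann product: m_U * m_W = 0 if U, W overlap, else (-1)^(inversions) m_(U \<union> W).\<close>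
definition gmul :: "'v::linorder grass \<Rightarrow> 'v grass \<Rightarrow> 'v grass" where
  "gmul X Y = (\<lambda>S. if finite S
      then (\<Sum>U\<in>Pow S. (-1::complex) ^ inv_count U (S - U) * X U * Y (S - U))
      else 0)"

definition gpow :: "'v::linorder grass \<Rightarrow> nat \<Rightarrow> 'v grass" where
  "gpow X n = ((gmul X) ^^ n) gone"

definition ggen :: "'v gen \<Rightarrow> 'v grass" where
  "ggen g = (\<lambda>S. if S = {g} then 1 else 0)"

definition psi :: "'v \<Rightarrow> 'v grass" where
  "psi i = ggen (i, True)"

definition psibar :: "'v \<Rightarrow> 'v grass" where
  "psibar i = ggen (i, False)"

text \<open>tau_A = prod_(i in A) psibar_i psi_i (the factors are even, so the order is irrelevant).\<close>
definition tau :: "'v::linorder set \<Rightarrow> 'v grass" where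
  "tau A = foldr (\<lambda>i acc. gmul (gmul (psibar i) (psi i)) acc) (sorted_list_of_set A) gone"

definition fA :: "complex \<Rightarrow> 'v::linorder set \<Rightarrow> 'v grass" where
  "fA lam A =
     gadd (gadd (gscale (lam * (1 - of_nat (card A))) (tau A))
                (gsum (\<lambda>i. tau (A - {i})) A))
          (gscale (-1) (gsum (\<lambda>(i, j). gmul (gmul (psibar i) (psi j)) (tau (A - {i, j})))
                              {(i, j). i \<in> A \<and> j \<in> A \<and> i \<noteq> j}))"

text \<open>Exponential of an even element X (living in the algebra generated by the 2|V| generators
  of V): exp(X) = e^(body X) * sum_(k <= 2|V|) (X - body X)^k / k!, the series being finite since
  X - body X is nilpotent of order at most 2|V|+1.\<close>
definition gexp :: "'v::linorder set \<Rightarrow> 'v grass \<Rightarrow> 'v grass" where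
  "gexp V X = (let N = gadd X (gscale (- X {}) gone) in
     (\<lambda>S. exp (X {}) * (\<Sum>k\<le>2 * card V. gpow N k S / of_nat (fact k))))"

text \<open>Berezin integral with D(psi,psibar) = prod_i dpsi_i dpsibar_i and
  int dpsi_i dpsibar_i psibar_i psi_i = 1: it extracts the coefficient of
  tau_V = psibar_1 psi_1 psibar_2 psi_2 ..., which is the canonical monomial V \<times> UNIV.\<close>
definition berezin :: "'v::linorder set \<Rightarrow> 'v grass \<Rightarrow> complex" where
  "berezin V X = X (V \<times> UNIV)"

definition hypergraph :: "'v set \<Rightarrow> 'v set set \<Rightarrow> bool" where
  "hypergraph V E \<longleftrightarrow> finite V \<and> (\<forall>A\<in>E. A \<subseteq> V \<and> card A \<ge> 2)"

text \<open>A cycle (v_0,e_1,v_1,...,e_k,v_k) in the hyperedge set F: vs = [v_0..v_k], es = [e_1..e_k].\<close>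
definition is_cycle :: "'v set set \<Rightarrow> 'v list \<Rightarrow> 'v set list \<Rightarrow> bool" where
  "is_cycle F vs es \<longleftrightarrow>
     length vs = length es + 1 \<and> length es \<ge> 2 \<and>
     (\<forall>i<length es. es ! i \<in> F \<and> vs ! i \<in> es ! i \<and> vs ! (i + 1) \<in> es ! i) \<and>
     distinct (butlast vs) \<and> last vs = hd vs \<and> distinct es"

definition hyperforest :: "'v set set \<Rightarrow> bool" where
  "hyperforest F \<longleftrightarrow> \<not> (\<exists>vs es. is_cycle F vs es)"

definition spanning_hyperforests :: "'v set set \<Rightarrow> 'v set set set" where
  "spanning_hyperforests E = {F. F \<subseteq> E \<and> hyperforest F}"

definition joined :: "'v set set \<Rightarrow> 'v \<Rightarrow> 'v \<Rightarrow> bool" where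
  "joined F = (\<lambda>x y. \<exists>A\<in>F. x \<in> A \<and> y \<in> A)\<^sup>*\<^sup>*"

definition components :: "'v set \<Rightarrow> 'v set set \<Rightarrow> 'v set set" where
  "components V F = (\<lambda>u. {v \<in> V. joined F u v}) ` V"

definition comp_edges :: "'v set set \<Rightarrow> 'v set \<Rightarrow> 'v set set" where
  "comp_edges F C = {A \<in> F. A \<subseteq> C}"

end

theory Submission
  imports Defs
begin

text \<open>
  The even part of the Grassmann algebra is a commutative ring, and every element in the exponent
  lies in it. There \<open>f_A = f_A^0 + c \<tau>_A\<close> with \<open>c = \<lambda>_A (1 - |A|)\<close>, where, for any root \<open>a \<in> A\<close>,
  \<open>f_A^0\<close> is the product over \<open>i \<in> A - {a}\<close> of
  \<open>(\<psi>bar_i - \<psi>bar_a) (\<psi>_i - \<psi>_a)\<close>.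
  Choosing the root in \<open>A \<inter> B\<close> shows that the elements with parameters \<open>c\<close> and \<open>d\<close> multiply to
  the element of \<open>A \<union> B\<close> with parameter \<open>c + d\<close> if \<open>|A \<inter> B| = 1\<close>, and to \<open>0\<close> if \<open>|A \<inter> B| \<ge> 2\<close>.
  All terms of the exponent square to zero, so its exponential is the product of the factors
  \<open>1 + w_A f_A\<close> and \<open>1 + t_i \<tau>_{i}\<close>, the latter being the element of the singleton \<open>{i}\<close> with
  parameter \<open>t_i\<close>. Expanding over sets \<open>F\<close> of hyperedges, the multiplication rule kills every \<open>F\<close>
  with a cycle and merges the factors of a forest along its components. The Berezin integral picks
  out the top-degree part, which is the product of the accumulated parameters.
\<close>


section \<open>The even part of the Grassmann algebra\<close>

lemma inv_count_Un_left:
  assumes "finite U" "finite U'" "finite W" "U \<inter> U' = {}"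
  shows "inv_count (U \<union> U') W = inv_count U W + inv_count U' W"
proof -
  have fin: "finite {(x, y). x \<in> X \<and> y \<in> W \<and> gless y x}" if "finite X" for X
    by (rule finite_subset[of _ "X \<times> W"]) (use that assms in auto)
  show ?thesis unfolding inv_count_def
    by (subst card_Un_disjoint[symmetric]) (use assms fin in \<open>auto intro!: arg_cong[where f = card]\<close>)
qed

lemma inv_count_Un_right:
  assumes "finite U" "finite W" "finite W'" "W \<inter> W' = {}"
  shows "inv_count U (W \<union> W') = inv_count U W + inv_count U W'"
proof -
  have fin: "finite {(x, y). x \<in> U \<and> y \<in> X \<and> gless y x}" if "finite X" for X
    by (rule finite_subset[of _ "U \<times> X"]) (use that assms in auto)
  show ?thesis unfolding inv_count_def
    by (subst card_Un_disjoint[symmetric]) (use assms fin in \<open>auto intro!: arg_cong[where f = card]\<close>)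
qed

text \<open>The generators are totally ordered, so each pair in \<open>U \<times> W\<close> is an
  inversion for exactly one of the two arrangements. This yields the sign of exchanging two
  monomials.\<close>

lemma inv_count_swap:
  assumes "finite U" "finite W" "U \<inter> W = {}"
  shows "inv_count U W + inv_count W U = card U * card W"
proof -
  have lin: "gless x y \<noteq> gless y x" if "x \<in> U" "y \<in> W" for x y :: "'a gen"
    using that assms(3) by (cases x; cases y) (auto simp: gless_def)
  have "inv_count W U = card ((\<lambda>(x, y). (y, x)) ` {(x, y). x \<in> U \<and> y \<in> W \<and> gless x y})"
    unfolding inv_count_def by (rule arg_cong[where f = card]) auto
  also have "\<dots> = card {(x, y). x \<in> U \<and> y \<in> W \<and> gless x y}"
    by (rule card_image) (auto simp: inj_on_def)
  finally have *: "inv_count W U = card {(x, y). x \<in> U \<and> y \<in> W \<and> gless x y}" .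
  have fin: "finite {(x, y). x \<in> U \<and> y \<in> W \<and> P x y}" for P
    by (rule finite_subset[of _ "U \<times> W"]) (use assms in auto)
  have "inv_count U W + inv_count W U = card (U \<times> W)"
    unfolding * unfolding inv_count_def
    by (subst card_Un_disjoint[symmetric])
      (use lin fin in \<open>auto intro!: arg_cong[where f = card]\<close>)
  then show ?thesis by (simp add: card_cartesian_product)
qed

text \<open>Both sides run over the ordered partitions of \<open>S\<close> into three blocks. The
  signs agree because inversion counts are additive in each argument, so either side counts the
  inversions between each two blocks once.\<close>

lemma gmul_assoc: "gmul (gmul X Y) Z = gmul X (gmul Y Z)"
proof
  fix S :: "'a gen set"
  show "gmul (gmul X Y) Z S = gmul X (gmul Y Z) S"
  proof (cases "finite S")
    case False
    then show ?thesis by (simp add: gmul_def)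
  next
    case True
    have fin: "finite U" if "U \<subseteq> S" for U using that True finite_subset by blast
    let ?s = "\<lambda>U W. (-1::complex) ^ inv_count U W"
    have "gmul (gmul X Y) Z S =
      (\<Sum>U\<in>Pow S. \<Sum>T\<in>Pow U. ?s U (S - U) * ?s T (U - T) * X T * Y (U - T) * Z (S - U))"
      using True fin by (auto simp: gmul_def sum_distrib_left sum_distrib_right mult_ac intro!: sum.cong)
    also have "\<dots> = (\<Sum>(U, T)\<in>(SIGMA U:Pow S. Pow U).
        ?s U (S - U) * ?s T (U - T) * X T * Y (U - T) * Z (S - U))" (is "_ = sum ?l _")
      by (rule sum.Sigma) (use True fin in auto)
    also have "\<dots> = (\<Sum>(T, W)\<in>(SIGMA T:Pow S. Pow (S - T)).
        ?s T (S - T) * ?s W (S - T - W) * X T * Y W * Z (S - T - W))" (is "_ = sum ?r _")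
    \<comment> \<open>A chain \<open>T \<subseteq> U \<subseteq> S\<close> and a pair of disjoint
      blocks \<open>T\<close>, \<open>W\<close> describe the same partition, with
      \<open>W = U - T\<close> and third block \<open>R = S - U\<close>.\<close>
    proof (rule sum.reindex_bij_witness[where i = "\<lambda>(T, W). (T \<union> W, T)" and j = "\<lambda>(U, T). (T, U - T)"])
      fix p assume "p \<in> (SIGMA U:Pow S. Pow U)"
      then obtain U T where p: "p = (U, T)" and UT: "U \<subseteq> S" "T \<subseteq> U" by auto
      define W R where "W = U - T" and "R = S - U"
      have eqs: "U = T \<union> W" "S - T = W \<union> R" "W \<union> R - W = R" "U - T = W"
        using UT by (auto simp: W_def R_def)
      have fins: "finite T" "finite W" "finite R"
        using UT fin by (auto simp: W_def R_def intro: fin)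
      have disj: "T \<inter> W = {}" "W \<inter> R = {}" by (auto simp: W_def R_def)
      have "inv_count U R + inv_count T W = inv_count T (W \<union> R) + inv_count W R"
        unfolding eqs(1) by (simp add: inv_count_Un_left inv_count_Un_right fins disj)
      then have "?s U R * ?s T W = ?s T (W \<union> R) * ?s W R"
        by (simp flip: power_add)
      then show "?r (case p of (U, T) \<Rightarrow> (T, U - T)) = ?l p"
        unfolding p by (simp add: eqs(2-4) R_def[symmetric])
    qed auto
    also have "\<dots> = (\<Sum>T\<in>Pow S. \<Sum>W\<in>Pow (S - T).
        ?s T (S - T) * ?s W (S - T - W) * X T * Y W * Z (S - T - W))"
      by (rule sum.Sigma[symmetric]) (use True fin in auto)
    also have "\<dots> = gmul X (gmul Y Z) S"
      using True fin by (auto simp: gmul_def sum_distrib_left sum_distrib_right mult_ac intro!: sum.cong)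
    finally show ?thesis .
  qed
qed

lemma gmul_nonzeroE:
  assumes "gmul X Y S \<noteq> 0"
  obtains U W where "X U \<noteq> 0" "Y W \<noteq> 0" "finite S" "S = U \<union> W" "U \<inter> W = {}" "card S = card U + card W"
proof -
  have fin: "finite S" using assms by (auto simp: gmul_def split: if_splits)
  then obtain U where U: "U \<in> Pow S" "(-1::complex) ^ inv_count U (S - U) * X U * Y (S - U) \<noteq> 0"
    using assms by (auto simp: gmul_def elim: sum.not_neutral_contains_not_neutral)
  show ?thesis
    by (rule that[of U "S - U"]) (use U fin in \<open>auto simp: card_Diff_subset finite_subset card_mono\<close>)
qed

text \<open>Products vanish on infinite sets, so the unit law is confined to elements that vanish
  there too.\<close>

lemma gmul_gone_left:
  assumes "\<And>S. X S \<noteq> 0 \<Longrightarrow> finite S"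
  shows "gmul gone X = X"
proof
  fix S show "gmul gone X S = X S"
  proof (cases "finite S")
    case True
    have "gmul gone X S = (\<Sum>U\<in>{{}}. (-1::complex) ^ inv_count U (S - U) * gone U * X (S - U))"
      unfolding gmul_def using True
      by (simp only: if_True, intro sum.mono_neutral_right) (auto simp: gone_def)
    then show ?thesis by (simp add: gone_def inv_count_def)
  qed (use assms in \<open>auto simp: gmul_def\<close>)
qed

text \<open>Passing from \<open>U\<close> to its complement in \<open>S\<close> exchanges the
  factors. The sign of this exchange has exponent \<open>card U * card (S - U)\<close>, which is
  even whenever \<open>X U\<close> is nonzero.\<close>

lemma gmul_commute_even:
  assumes "\<And>S. X S \<noteq> 0 \<Longrightarrow> even (card S)"
  shows "gmul X Y = gmul Y X"
proof
  fix S show "gmul X Y S = gmul Y X S"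
  proof (cases "finite S")
    case True
    have "(\<Sum>U\<in>Pow S. (-1::complex) ^ inv_count U (S - U) * X U * Y (S - U)) =
      (\<Sum>W\<in>Pow S. (-1::complex) ^ inv_count W (S - W) * Y W * X (S - W))"
    proof (rule sum.reindex_bij_witness[where i = "\<lambda>U. S - U" and j = "\<lambda>U. S - U"])
      fix U assume U: "U \<in> Pow S"
      then have SU: "S - (S - U) = U" by auto
      show "(-1::complex) ^ inv_count (S - U) (S - (S - U)) * Y (S - U) * X (S - (S - U)) =
          (-1) ^ inv_count U (S - U) * X U * Y (S - U)"
      proof (cases "X U = 0")
        case False
        have "inv_count U (S - U) + inv_count (S - U) U = card U * card (S - U)"
          by (rule inv_count_swap) (use U True finite_subset in auto)
        then have "even (inv_count U (S - U) + inv_count (S - U) U)"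
          using assms[OF False] by simp
        then have "(-1::complex) ^ inv_count U (S - U) = (-1) ^ inv_count (S - U) U"
          by (auto simp: minus_one_power_iff)
        then show ?thesis using SU by simp
      qed (simp add: SU)
    qed auto
    then show ?thesis using True by (simp add: gmul_def)
  qed (simp add: gmul_def)
qed

lemma gmul_gadd_left: "gmul (gadd X Y) Z = gadd (gmul X Z) (gmul Y Z)"
  by (rule ext) (simp add: gmul_def gadd_def sum.distrib algebra_simps)

lemma gmul_gscale_left: "gmul (gscale c X) Y = gscale c (gmul X Y)"
  by (rule ext) (simp add: gmul_def gscale_def sum_distrib_left mult_ac)

lemma gmul_gscale_right: "gmul X (gscale c Y) = gscale c (gmul X Y)"
  by (rule ext) (simp add: gmul_def gscale_def sum_distrib_left mult_ac)

lemma gmul_ggen_ggen: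
  "gmul (ggen a) (ggen b) = (\<lambda>S. if a \<noteq> b \<and> S = {a, b} then (if gless b a then -1 else 1) else 0)"
proof
  fix S
  show "gmul (ggen a) (ggen b) S = (if a \<noteq> b \<and> S = {a, b} then (if gless b a then -1 else 1) else 0)"
  proof (cases "a \<noteq> b \<and> S = {a, b}")
    case True
    then have *: "S - {a} = {b}" "{a} \<in> Pow S" and fin: "finite (Pow S)" by auto
    have "gmul (ggen a) (ggen b) S =
        (\<Sum>U\<in>{{a}}. (-1::complex) ^ inv_count U (S - U) * ggen a U * ggen b (S - U))"
      unfolding gmul_def using True
      by (simp only: if_True finite.intros, intro sum.mono_neutral_right) (auto simp: ggen_def)
    also have "\<dots> = (-1) ^ inv_count {a} {b}" using * by (simp add: ggen_def)
    also have "inv_count {a} {b} = (if gless b a then 1 else 0)"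
    proof -
      have "{(x, y). x \<in> {a} \<and> y \<in> {b} \<and> gless y x} = (if gless b a then {(a, b)} else {})" by auto
      then show ?thesis by (simp add: inv_count_def)
    qed
    finally show ?thesis using True by simp
  next
    case False
    have "gmul (ggen a) (ggen b) S = 0"
    proof (rule ccontr)
      assume "\<not> ?thesis"
      then show False
        by (rule gmul_nonzeroE) (use False in \<open>auto simp: ggen_def split: if_splits\<close>)
    qed
    then show ?thesis using False by simp
  qed
qed

lemma ggen_anticommute: "gmul (ggen a) (ggen b) = gscale (-1) (gmul (ggen b) (ggen a))"
  by (rule ext; cases a; cases b) (auto simp: gmul_ggen_ggen gscale_def gless_def insert_commute)

section \<open>The commutative ring of even elements\<close>

text \<open>Evenness makes multiplication commutative, and finiteness of the sets with nonzero
  coefficient makes \<open>gone\<close> a unit. Generic ring algebra, \<open>prod\<close> and powers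
  thus become available.\<close>

typedef (overloaded) 'v even_grass = "{X :: 'v::linorder grass. \<forall>S. X S \<noteq> 0 \<longrightarrow> finite S \<and> even (card S)}"
  morphisms coeff Abs_even_grass
  by (rule exI[of _ "\<lambda>_. 0"]) auto

setup_lifting type_definition_even_grass

instantiation even_grass :: (linorder) comm_ring_1
begin

lift_definition zero_even_grass :: "'a even_grass" is gzero by (simp add: gzero_def)
lift_definition one_even_grass :: "'a even_grass" is gone by (auto simp: gone_def split: if_splits)
lift_definition plus_even_grass :: "'a even_grass \<Rightarrow> 'a even_grass \<Rightarrow> 'a even_grass" is gadd
  by (metis add.right_neutral gadd_def)
lift_definition uminus_even_grass :: "'a even_grass \<Rightarrow> 'a even_grass" is "gscale (-1)"
  by (auto simp: gscale_def)
lift_definition minus_even_grass :: "'a even_grass \<Rightarrow> 'a even_grass \<Rightarrow> 'a even_grass" is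
  "\<lambda>X Y. gadd X (gscale (-1) Y)"
  by (metis add.right_neutral gadd_def gscale_def mult_zero_right)
lift_definition times_even_grass :: "'a even_grass \<Rightarrow> 'a even_grass \<Rightarrow> 'a even_grass" is gmul
  by (auto elim!: gmul_nonzeroE)

instance
proof
  fix a b c :: "'a even_grass"
  show "a + b + c = a + (b + c)" by transfer (simp add: gadd_def add.assoc)
  show "a + b = b + a" by transfer (simp add: gadd_def add.commute)
  show "0 + a = a" by transfer (simp add: gadd_def gzero_def)
  show "- a + a = 0" by transfer (simp add: gadd_def gzero_def gscale_def)
  show "a - b = a + - b" by transfer simp
  show "a * b * c = a * (b * c)" by transfer (rule gmul_assoc)
  show "a * b = b * a" by transfer (rule gmul_commute_even; blast)
  show "1 * a = a" by transfer (rule gmul_gone_left; blast)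
  show "(a + b) * c = a * c + b * c" by transfer (rule gmul_gadd_left)
  show "(0::'a even_grass) \<noteq> 1" by transfer (auto simp: gzero_def gone_def dest: fun_cong[of _ _ "{}"])
qed

end

lift_definition const :: "complex \<Rightarrow> 'v::linorder even_grass" is "\<lambda>c. gscale c gone"
  by (auto simp: gscale_def gone_def split: if_splits)

lift_definition bilin :: "'v::linorder \<Rightarrow> 'v \<Rightarrow> 'v even_grass" is "\<lambda>i j. gmul (psibar i) (psi j)"
  by (auto simp: psi_def psibar_def gmul_ggen_ggen split: if_splits)

lemma coeff_zero [simp]: "coeff 0 S = 0"
  by transfer (simp add: gzero_def)

lemma coeff_one [simp]: "coeff 1 S = (if S = {} then 1 else 0)"
  by transfer (simp add: gone_def)

lemma coeff_add [simp]: "coeff (X + Y) S = coeff X S + coeff Y S"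
  by transfer (simp add: gadd_def)

lemma coeff_minus [simp]: "coeff (- X) S = - coeff X S"
  by transfer (simp add: gscale_def)

lemma coeff_diff [simp]: "coeff (X - Y) S = coeff X S - coeff Y S"
  by transfer (simp add: gscale_def gadd_def)

lemma coeff_sum [simp]: "coeff (sum f I) S = (\<Sum>a\<in>I. coeff (f a) S)"
  by (induction I rule: infinite_finite_induct) auto

lemma coeff_const_mult [simp]: "coeff (const c * X) S = c * coeff X S"
proof -
  have "coeff (const c * X) = gscale c (coeff X)"
    by transfer (simp add: gmul_gscale_left gmul_gone_left)
  then show ?thesis by (simp add: gscale_def)
qed

lemma coeff_of_nat_mult [simp]: "coeff (of_nat n * X) S = of_nat n * coeff X S"
  by (induction n) (simp_all add: algebra_simps)

lemma even_grass_eqI: "(\<And>S. coeff X S = coeff Y S) \<Longrightarrow> X = Y"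
  by (simp add: ext flip: coeff_inject)

lemma const_add: "const (a + b) = const a + const b"
  by transfer (simp add: gscale_def gadd_def fun_eq_iff algebra_simps)

lemma const_mult: "const (a * b) = const a * const b"
  by (rule even_grass_eqI) (simp add: const.rep_eq gscale_def)

lemma const_1 [simp]: "const 1 = 1"
  by transfer (simp add: gscale_def gone_def)

lemma const_prod: "const (prod f I) = (\<Prod>a\<in>I. const (f a))"
  by (induction I rule: infinite_finite_induct) (auto simp: const_mult)

text \<open>Both sides are brought to the order psibar psibar psi psi at the cost of the same sign,
  and then differ by the exchange of \<open>psi j\<close> and \<open>psi l\<close>. The
  multiplication rules for hyperedge elements draw on anticommutation only through this
  identity.\<close>

lemma bilin_swap: "bilin i j * bilin k l = - (bilin i l * bilin k j)"
proof transfer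
  fix i j k l :: 'a
  let ?P = "gmul (gmul (psibar i) (psibar k)) (gmul (psi j) (psi l))"
  have sw: "gmul (gmul (psibar i) (psi a)) (gmul (psibar k) (psi b)) =
      gscale (-1) (gmul (gmul (psibar i) (psibar k)) (gmul (psi a) (psi b)))" for a b
  proof -
    have "gmul (gmul (psibar i) (psi a)) (gmul (psibar k) (psi b)) =
       gmul (psibar i) (gmul (gmul (psi a) (psibar k)) (psi b))" by (simp add: gmul_assoc)
    also have "gmul (psi a) (psibar k) = gscale (-1) (gmul (psibar k) (psi a))"
      unfolding psi_def psibar_def by (rule ggen_anticommute)
    finally show ?thesis by (simp add: gmul_assoc gmul_gscale_left gmul_gscale_right)
  qed
  have "gmul (psi l) (psi j) = gscale (-1) (gmul (psi j) (psi l))"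
    unfolding psi_def by (rule ggen_anticommute)
  then have "gmul (gmul (psibar i) (psibar k)) (gmul (psi l) (psi j)) = gscale (-1) ?P"
    by (simp add: gmul_gscale_right)
  then show "gmul (gmul (psibar i) (psi j)) (gmul (psibar k) (psi l)) =
      gscale (-1) (gmul (gmul (psibar i) (psi l)) (gmul (psibar k) (psi j)))"
    unfolding sw by (simp add: gscale_def)
qed

lemma even_grass_eq_neg_self:
  fixes X :: "'v::linorder even_grass"
  assumes "X = - X"
  shows "X = 0"
proof (rule even_grass_eqI)
  fix S
  have "coeff X S = - coeff X S" using assms by (metis coeff_minus)
  then show "coeff X S = coeff 0 S" by simp
qed

text \<open>With equal psibar indices, \<open>bilin_swap\<close> returns the same product up to
  order, so it is its own negative.\<close>

lemma bilin_same_left: "bilin i j * bilin i l = 0"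
  by (rule even_grass_eq_neg_self) (metis bilin_swap mult.commute)

lemma bilin_same_right: "bilin i j * bilin k j = 0"
  by (rule even_grass_eq_neg_self) (metis bilin_swap mult.commute)

section \<open>Products of hyperedge elements\<close>

definition tau_even :: "'v::linorder set \<Rightarrow> 'v even_grass" where
  "tau_even A = (\<Prod>i\<in>A. bilin i i)"

text \<open>This is f_A with lambda = 0.\<close>

definition core :: "'v::linorder set \<Rightarrow> 'v even_grass" where
  "core A = (\<Sum>i\<in>A. tau_even (A - {i}) - (\<Sum>j\<in>A - {i}. bilin i j * tau_even (A - {i, j})))"

text \<open>This is (psibar_i - psibar_a) (psi_i - psi_a), expanded so as to stay within the even
  part.\<close>

definition diff_bilin :: "'v::linorder \<Rightarrow> 'v \<Rightarrow> 'v even_grass" where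
  "diff_bilin i a = bilin i i + bilin a a - bilin i a - bilin a i"

text \<open>The coefficient of tau is a free parameter instead of lambda (1 - |A|): parameters add
  when elements merge, and a singleton has to carry \<open>t i\<close> although 1 - |A| is 0
  there.\<close>

definition hyperedge_elem :: "'v::linorder set \<Rightarrow> complex \<Rightarrow> 'v even_grass" where
  "hyperedge_elem A c = core A + const c * tau_even A"

section \<open>Multiplying \<open>tau_even\<close> and \<open>core\<close> by bilinears; the rooted
  product form of \<open>core\<close>\<close>

lemma bilin_mult_bilin_left: "bilin i j * X * bilin i l = 0"
  using bilin_same_left[of i j l] by (simp add: mult.commute[of _ X] mult.assoc)

lemma bilin_mult_bilin_right: "bilin i j * X * bilin k j = 0"
  using bilin_same_right[of i j k] by (simp add: mult.commute[of _ X] mult.assoc)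

lemma tau_even_empty [simp]: "tau_even {} = 1"
  by (simp add: tau_even_def)

lemma tau_even_insert: "finite A \<Longrightarrow> a \<notin> A \<Longrightarrow> tau_even (insert a A) = bilin a a * tau_even A"
  by (simp add: tau_even_def)

lemma tau_even_remove: "finite A \<Longrightarrow> a \<in> A \<Longrightarrow> tau_even A = bilin a a * tau_even (A - {a})"
  unfolding tau_even_def by (rule prod.remove)

lemma tau_even_bilin_left:
  assumes "finite A" "a \<in> A" shows "tau_even A * bilin a b = 0"
proof -
  have "tau_even A * bilin a b = tau_even (A - {a}) * (bilin a a * bilin a b)"
    using assms by (simp add: tau_even_remove[of A a] mult_ac)
  then show ?thesis by (simp add: bilin_same_left)
qed

lemma tau_even_bilin_right:
  assumes "finite A" "a \<in> A" shows "tau_even A * bilin b a = 0"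
proof -
  have "tau_even A * bilin b a = tau_even (A - {a}) * (bilin a a * bilin b a)"
    using assms by (simp add: tau_even_remove[of A a] mult_ac)
  then show ?thesis by (simp add: bilin_same_right)
qed

lemma tau_even_mult_eq_0:
  assumes "finite A" "finite B" "a \<in> A" "a \<in> B" shows "tau_even A * tau_even B = 0"
proof -
  have "tau_even A * tau_even B = (tau_even A * bilin a a) * tau_even (B - {a})"
    using tau_even_remove[OF assms(2,4)] by (simp add: mult_ac)
  then show ?thesis using tau_even_bilin_left[OF assms(1,3)] by simp
qed

lemma tau_even_Un_disjoint: "finite A \<Longrightarrow> finite B \<Longrightarrow> A \<inter> B = {} \<Longrightarrow> tau_even (A \<union> B) = tau_even A * tau_even B"
  by (simp add: tau_even_def prod.union_disjoint)

text \<open>Among the terms of \<open>core A\<close>, only \<open>tau_even (A - {a})\<close> is free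
  of both \<open>psibar a\<close> and \<open>psi a\<close>, and \<open>bilin a a\<close> completes
  it.\<close>

lemma core_mult_bilin_diag:
  assumes "finite A" "a \<in> A" shows "core A * bilin a a = tau_even A"
proof -
  let ?t = "\<lambda>i. (tau_even (A - {i}) - (\<Sum>j\<in>A - {i}. bilin i j * tau_even (A - {i, j}))) * bilin a a"
  have "?t i = 0" if "i \<in> A - {a}" for i
  proof -
    have "tau_even (A - {i}) * bilin a a = 0" by (rule tau_even_bilin_left) (use assms that in auto)
    moreover have "bilin i j * tau_even (A - {i, j}) * bilin a a = 0" if "j \<in> A - {i}" for j
    proof (cases "j = a")
      case True
      then show ?thesis by (simp add: bilin_mult_bilin_right)
    next
      case False
      then have "tau_even (A - {i, j}) * bilin a a = 0"
        by (intro tau_even_bilin_left) (use assms that \<open>i \<in> A - {a}\<close> in auto)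
      then show ?thesis by (simp add: mult.assoc)
    qed
    ultimately show ?thesis by (simp add: left_diff_distrib sum_distrib_right)
  qed
  then have "core A * bilin a a = ?t a"
    unfolding core_def sum_distrib_right
    using assms by (subst sum.remove[of A a]) (auto intro: sum.neutral)
  also have "\<dots> = tau_even A"
  proof -
    have "bilin a j * tau_even (A - {a, j}) * bilin a a = 0" for j
      by (simp add: bilin_mult_bilin_left)
    then show ?thesis
      using assms by (simp add: left_diff_distrib sum_distrib_right) (simp add: tau_even_remove[of A a] mult.commute)
  qed
  finally show ?thesis .
qed

text \<open>The terms free of \<open>psibar a\<close> survive: \<open>tau_even (A - {a})\<close>,
  and in each summand i \<noteq> a the term j = a. There \<open>bilin_swap\<close> turns
  \<open>bilin i a * bilin a b\<close> into \<open>- (bilin i b * bilin a a)\<close>, and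
  \<open>bilin a a\<close> completes the tau. The result no longer depends on the choice of a in
  \<open>A\<close>.\<close>

lemma core_mult_bilin_right:
  assumes "finite A" "a \<in> A" shows "core A * bilin a b = (\<Sum>i\<in>A. bilin i b * tau_even (A - {i}))"
  unfolding core_def sum_distrib_right
proof (rule sum.cong[OF refl])
  fix i assume i: "i \<in> A"
  show "(tau_even (A - {i}) - (\<Sum>j\<in>A - {i}. bilin i j * tau_even (A - {i, j}))) * bilin a b =
      bilin i b * tau_even (A - {i})"
  proof (cases "i = a")
    case True
    have "bilin a j * tau_even (A - {a, j}) * bilin a b = 0" for j
      by (simp add: bilin_mult_bilin_left)
    then show ?thesis unfolding True left_diff_distrib sum_distrib_right by (simp add: mult.commute)
  next
    case False
    have 1: "tau_even (A - {i}) * bilin a b = 0" by (rule tau_even_bilin_left) (use assms False in auto)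
    have 2: "bilin i j * tau_even (A - {i, j}) * bilin a b = 0" if "j \<in> A - {i} - {a}" for j
    proof -
      have "tau_even (A - {i, j}) * bilin a b = 0"
        by (intro tau_even_bilin_left) (use assms that False in auto)
      then show ?thesis by (simp add: mult.assoc)
    qed
    have "bilin i a * tau_even (A - {i, a}) * bilin a b = (bilin i a * bilin a b) * tau_even (A - {i, a})"
      by (simp add: mult_ac)
    also have "\<dots> = - (bilin i b * (bilin a a * tau_even (A - {i, a})))"
      unfolding bilin_swap[of i a a b] by (simp add: mult_ac)
    also have "bilin a a * tau_even (A - {i, a}) = tau_even (A - {i})"
    proof -
      have "tau_even (A - {i}) = bilin a a * tau_even (A - {i} - {a})"
        by (rule tau_even_remove) (use assms False in auto)
      also have "A - {i} - {a} = A - {i, a}" by auto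
      finally show ?thesis by (rule sym)
    qed
    finally have 3: "bilin i a * tau_even (A - {i, a}) * bilin a b = - (bilin i b * tau_even (A - {i}))" .
    have "(\<Sum>j\<in>A - {i}. bilin i j * tau_even (A - {i, j}) * bilin a b) = - (bilin i b * tau_even (A - {i}))"
      using assms False 2 3 by (subst sum.remove[of _ a]) (auto intro: sum.neutral)
    then show ?thesis using 1 by (simp add: left_diff_distrib sum_distrib_right)
  qed
qed

text \<open>Mirror image for \<open>psi a\<close>: all terms free of it sit in the summand i = a,
  which alone unfolds into the whole sum.\<close>

lemma core_mult_bilin_left:
  assumes "finite A" "a \<in> A" shows "core A * bilin b a = (\<Sum>i\<in>A. bilin b i * tau_even (A - {i}))"
proof -
  let ?t = "\<lambda>i. (tau_even (A - {i}) - (\<Sum>j\<in>A - {i}. bilin i j * tau_even (A - {i, j}))) * bilin b a"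
  have "?t i = 0" if "i \<in> A - {a}" for i
  proof -
    have "tau_even (A - {i}) * bilin b a = 0" by (rule tau_even_bilin_right) (use assms that in auto)
    moreover have "bilin i j * tau_even (A - {i, j}) * bilin b a = 0" if "j \<in> A - {i}" for j
    proof (cases "j = a")
      case True
      then show ?thesis by (simp add: bilin_mult_bilin_right)
    next
      case False
      then have "tau_even (A - {i, j}) * bilin b a = 0"
        by (intro tau_even_bilin_right) (use assms that \<open>i \<in> A - {a}\<close> in auto)
      then show ?thesis by (simp add: mult.assoc)
    qed
    ultimately show ?thesis by (simp add: left_diff_distrib sum_distrib_right)
  qed
  then have "core A * bilin b a = ?t a"
    unfolding core_def sum_distrib_right
    using assms by (subst sum.remove[of A a]) (auto intro: sum.neutral)
  also have "\<dots> = bilin b a * tau_even (A - {a}) + (\<Sum>j\<in>A - {a}. bilin b j * tau_even (A - {j}))"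
  proof -
    have "bilin a j * tau_even (A - {a, j}) * bilin b a = - (bilin b j * tau_even (A - {j}))" if "j \<in> A - {a}" for j
    proof -
      have "bilin a j * tau_even (A - {a, j}) * bilin b a = (bilin a j * bilin b a) * tau_even (A - {a, j})"
        by (simp add: mult_ac)
      also have "\<dots> = - (bilin b j * (bilin a a * tau_even (A - {a, j})))"
        unfolding bilin_swap[of a j b a] by (simp add: mult_ac)
      also have "bilin a a * tau_even (A - {a, j}) = tau_even (A - {j})"
      proof -
        have "tau_even (A - {j}) = bilin a a * tau_even (A - {j} - {a})"
          by (rule tau_even_remove) (use assms that in auto)
        also have "A - {j} - {a} = A - {a, j}" by auto
        finally show ?thesis by (rule sym)
      qed
      finally show ?thesis .
    qed
    then have "(\<Sum>j\<in>A - {a}. bilin a j * tau_even (A - {a, j}) * bilin b a) =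
        (\<Sum>j\<in>A - {a}. - (bilin b j * tau_even (A - {j})))"
      by (rule sum.cong[OF refl])
    then show ?thesis
      unfolding left_diff_distrib sum_distrib_right
      by (simp only: sum_negf diff_minus_eq_add mult.commute[of _ "bilin b a"])
  qed
  also have "\<dots> = (\<Sum>i\<in>A. bilin b i * tau_even (A - {i}))"
    by (rule sum.remove[OF assms, symmetric])
  finally show ?thesis .
qed

text \<open>The terms of \<open>core (insert b A)\<close> fall into four groups: b removed alone, b
  as psibar index, b as psi index, and b inside tau. Up to sign they match the products of
  \<open>core A\<close> with \<open>bilin a a\<close>, \<open>bilin b a\<close>,
  \<open>bilin a b\<close> and \<open>bilin b b\<close>.\<close>

lemma core_insert:
  assumes "finite A" "a \<in> A" "b \<notin> A"
  shows "core (insert b A) = core A * diff_bilin b a"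
proof -
  let ?t = "\<lambda>i. tau_even (insert b A - {i}) - (\<Sum>j\<in>insert b A - {i}. bilin i j * tau_even (insert b A - {i, j}))"
  have t: "?t i = (tau_even (A - {i}) - (\<Sum>j\<in>A - {i}. bilin i j * tau_even (A - {i, j}))) * bilin b b
        - bilin i b * tau_even (A - {i})" if "i \<in> A" for i
  proof -
    have ib: "i \<noteq> b" using that assms by auto
    have "tau_even (insert b A - {i}) = bilin b b * tau_even (A - {i})"
      using assms ib by (simp add: insert_Diff_if tau_even_insert)
    moreover have "tau_even (insert b A - {i, j}) = bilin b b * tau_even (A - {i, j})" if "j \<in> A - {i}" for j
      using assms ib that by (auto simp: insert_Diff_if tau_even_insert)
    moreover have "insert b A - {i} = insert b (A - {i})" "insert b A - {i, b} = A - {i}"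
      using ib assms by auto
    ultimately show ?thesis
      using assms by (simp add: algebra_simps sum_distrib_left)
  qed
  have "sum ?t A = core A * bilin b b - (\<Sum>i\<in>A. bilin i b * tau_even (A - {i}))"
  proof -
    have "sum ?t A = (\<Sum>i\<in>A. (tau_even (A - {i}) - (\<Sum>j\<in>A - {i}. bilin i j * tau_even (A - {i, j}))) * bilin b b
        - bilin i b * tau_even (A - {i}))" by (rule sum.cong[OF refl t])
    also have "\<dots> = core A * bilin b b - (\<Sum>i\<in>A. bilin i b * tau_even (A - {i}))"
      unfolding core_def sum_distrib_right by (rule sum_subtractf)
    finally show ?thesis .
  qed
  moreover have "insert b A - {b} = A" "\<And>j. insert b A - {b, j} = A - {j}" using assms by auto
  moreover have "core (insert b A) = ?t b + sum ?t A"
    using assms unfolding core_def by (intro sum.insert)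
  ultimately have "core (insert b A) = tau_even A - (\<Sum>j\<in>A. bilin b j * tau_even (A - {j}))
      + (core A * bilin b b - (\<Sum>i\<in>A. bilin i b * tau_even (A - {i})))"
    by simp
  also have "\<dots> = core A * diff_bilin b a"
    using assms by (simp add: diff_bilin_def ring_distribs core_mult_bilin_diag
        core_mult_bilin_left core_mult_bilin_right)
  finally show ?thesis .
qed

lemma core_singleton [simp]: "core {i} = 1"
  by (simp add: core_def)

lemma core_eq_prod:
  assumes "finite A" "a \<in> A"
  shows "core A = (\<Prod>i\<in>A - {a}. diff_bilin i a)"
proof -
  have "core (insert a B) = (\<Prod>i\<in>B. diff_bilin i a)" if "finite B" "a \<notin> B" for B
    using that
  proof (induction B rule: finite_induct)
    case (insert b B)
    then have "core (insert b (insert a B)) = core (insert a B) * diff_bilin b a"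
      by (intro core_insert) auto
    with insert show ?case by (simp add: insert_commute mult.commute)
  qed simp
  from this[of "A - {a}"] assms show ?thesis by (simp add: insert_absorb)
qed

section \<open>The multiplication rule for hyperedge elements\<close>

lemma diff_bilin_square: "diff_bilin i a * diff_bilin i a = 0"
proof -
  \<comment> \<open>Only the products of x with y and of u with v have no repeated generator, and
    \<open>bilin_swap\<close> makes these two opposite.\<close>
  have "(x + y - u - v) * (x + y - u - v) = (x * y + x * y + u * v + u * v) + x * x + y * y + u * u + v * v
     - (x * u + x * u + x * v + x * v + y * u + y * u + y * v + y * v)" for x y u v :: "'a even_grass"
    by (simp add: algebra_simps)
  from this[of "bilin i i" "bilin a a" "bilin i a" "bilin a i"] show ?thesis
    unfolding diff_bilin_def bilin_swap[of i a a i] by (simp add: bilin_same_left bilin_same_right)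
qed

lemma core_mult_core_one:
  assumes "finite A" "finite B" "A \<inter> B = {a}"
  shows "core A * core B = core (A \<union> B)"
proof -
  have "A \<union> B - {a} = (A - {a}) \<union> (B - {a})" "(A - {a}) \<inter> (B - {a}) = {}" "a \<in> A" "a \<in> B"
    using assms by auto
  then show ?thesis
    using assms by (simp add: core_eq_prod[where a = a] prod.union_disjoint)
qed

text \<open>Rooted at a, both factors contain \<open>diff_bilin b a\<close>, which squares to
  zero.\<close>

lemma core_mult_core_two:
  assumes "finite A" "finite B" "a \<in> A \<inter> B" "b \<in> A \<inter> B" "a \<noteq> b"
  shows "core A * core B = 0"
proof -
  have *: "\<exists>X. core C = diff_bilin b a * X" if "finite C" "a \<in> C" "b \<in> C" for C
    using that assms(5) by (auto simp: core_eq_prod[where a = a] prod.remove[of _ b])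
  then obtain X Y where "core A = diff_bilin b a * X" "core B = diff_bilin b a * Y"
    using *[of A] *[of B] assms by blast
  then have "core A * core B = (diff_bilin b a * diff_bilin b a) * (X * Y)" by (simp add: mult_ac)
  then show ?thesis by (simp add: diff_bilin_square)
qed

text \<open>The factor \<open>bilin a a\<close> split off from \<open>tau_even A\<close> turns
  \<open>core B\<close> into \<open>tau_even B\<close>.\<close>

lemma tau_even_mult_core:
  assumes "finite A" "finite B" "a \<in> A" "a \<in> B"
  shows "tau_even A * core B = tau_even (A - {a}) * tau_even B"
proof -
  have "tau_even A * core B = tau_even (A - {a}) * (core B * bilin a a)"
    using assms by (simp add: tau_even_remove[of A a] mult_ac)
  then show ?thesis using assms by (simp add: core_mult_bilin_diag)
qed

lemma tau_even_mult_core_one: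
  assumes "finite A" "finite B" "A \<inter> B = {a}"
  shows "tau_even A * core B = tau_even (A \<union> B)"
proof -
  have "tau_even A * core B = tau_even (A - {a}) * tau_even B" by (rule tau_even_mult_core) (use assms in auto)
  also have "\<dots> = tau_even ((A - {a}) \<union> B)" by (rule tau_even_Un_disjoint[symmetric]) (use assms in auto)
  also have "(A - {a}) \<union> B = A \<union> B" using assms by auto
  finally show ?thesis .
qed

lemma tau_even_mult_core_two:
  assumes "finite A" "finite B" "a \<in> A \<inter> B" "b \<in> A \<inter> B" "a \<noteq> b"
  shows "tau_even A * core B = 0"
proof -
  have "tau_even A * core B = tau_even (A - {a}) * tau_even B" by (rule tau_even_mult_core) (use assms in auto)
  also have "\<dots> = 0" by (rule tau_even_mult_eq_0[of _ _ b]) (use assms in auto)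
  finally show ?thesis .
qed

text \<open>The parameters add because each mixed product of a tau with a core is the tau of the
  union, while the two taus share generators and multiply to 0.\<close>

lemma hyperedge_elem_mult_one:
  assumes "finite A" "finite B" "A \<inter> B = {a}"
  shows "hyperedge_elem A c * hyperedge_elem B d = hyperedge_elem (A \<union> B) (c + d)"
proof -
  have "tau_even A * tau_even B = 0" by (rule tau_even_mult_eq_0[of _ _ a]) (use assms in auto)
  moreover have "tau_even B * core A = tau_even (A \<union> B)"
    using tau_even_mult_core_one[of B A a] assms by (simp add: Int_commute Un_commute)
  moreover have "hyperedge_elem A c * hyperedge_elem B d =
      core A * core B + const c * (tau_even A * core B) + const d * (tau_even B * core A)
      + const c * const d * (tau_even A * tau_even B)"
    by (simp add: hyperedge_elem_def algebra_simps)
  ultimately show ?thesis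
    using core_mult_core_one[OF assms] tau_even_mult_core_one[OF assms]
    by (simp add: hyperedge_elem_def const_add distrib_right)
qed

lemma hyperedge_elem_mult_two:
  assumes "finite A" "finite B" "a \<in> A \<inter> B" "b \<in> A \<inter> B" "a \<noteq> b"
  shows "hyperedge_elem A c * hyperedge_elem B d = 0"
proof -
  have "tau_even A * tau_even B = 0" by (rule tau_even_mult_eq_0[of _ _ a]) (use assms in auto)
  moreover have "tau_even B * core A = 0"
    using tau_even_mult_core_two[of B A a b] assms by auto
  moreover have "hyperedge_elem A c * hyperedge_elem B d =
      core A * core B + const c * (tau_even A * core B) + const d * (tau_even B * core A)
      + const c * const d * (tau_even A * tau_even B)"
    by (simp add: hyperedge_elem_def algebra_simps)
  ultimately show ?thesis
    using core_mult_core_two[OF assms] tau_even_mult_core_two[OF assms] by simp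
qed

lemma hyperedge_elem_singleton: "hyperedge_elem {i} c = 1 + const c * bilin i i"
  by (simp add: hyperedge_elem_def tau_even_def)

section \<open>Degrees, exponentials and the Berezin integral\<close>

lemma coeff_mult_nonzeroE:
  assumes "coeff (X * Y) S \<noteq> 0"
  obtains U W where "coeff X U \<noteq> 0" "coeff Y W \<noteq> 0" "finite S" "S = U \<union> W" "U \<inter> W = {}"
    "card S = card U + card W"
  using assms unfolding times_even_grass.rep_eq by (rule gmul_nonzeroE) blast

lemma coeff_mult_empty: "coeff (X * Y) {} = coeff X {} * coeff Y {}"
  by (simp add: times_even_grass.rep_eq gmul_def inv_count_def)

lemma coeff_nonzero_finite: "coeff X S \<noteq> 0 \<Longrightarrow> finite S"
  using coeff[of X] by simp

lemma card_of_coeff_bilin: "coeff (bilin i j) S \<noteq> 0 \<Longrightarrow> card S = 2"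
  by (auto simp: bilin.rep_eq psi_def psibar_def gmul_ggen_ggen split: if_splits)

lemma coeff_bilin_empty [simp]: "coeff (bilin i j) {} = 0"
  using card_of_coeff_bilin[of i j "{}"] by auto

lemma coeff_bilin_diag: "coeff (bilin i i) S = (if S = {i} \<times> UNIV then 1 else 0)"
  by (auto simp: bilin.rep_eq psi_def psibar_def gmul_ggen_ggen gless_def UNIV_bool)

text \<open>In the vertex-major order both generators of b come after exactly the generators of the
  smaller vertices, so inversions come in pairs. This is why tau has coefficient +1 on its canonical
  monomial.\<close>

lemma even_inv_count_pair:
  fixes b :: "'v::linorder"
  assumes "finite A" "b \<notin> A"
  shows "even (inv_count ({b} \<times> UNIV) (A \<times> UNIV))"
proof -
  define Y :: "'v gen set" where "Y = {y \<in> A \<times> UNIV. fst y < b}"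
  have "{(x, y). x \<in> {b} \<times> (UNIV :: bool set) \<and> y \<in> A \<times> UNIV \<and> gless y x} = ({b} \<times> UNIV) \<times> Y"
    using assms by (auto simp: Y_def gless_def)
  then show ?thesis by (simp add: inv_count_def card_cartesian_product)
qed

lemma coeff_tau_even:
  assumes "finite A"
  shows "coeff (tau_even A) S = (if S = A \<times> UNIV then 1 else 0)"
  using assms
proof (induction A arbitrary: S rule: finite_induct)
  case (insert b A)
  have tau: "tau_even (insert b A) = bilin b b * tau_even A"
    using insert by (simp add: tau_even_insert)
  show ?case
  proof (cases "S = insert b A \<times> UNIV")
    case False
    have "coeff (bilin b b * tau_even A) S = 0"
    proof (rule ccontr)
      assume "\<not> ?thesis"
      then show False
        by (rule coeff_mult_nonzeroE)
          (use insert.IH False in \<open>auto simp: coeff_bilin_diag split: if_splits\<close>)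
    qed
    with False tau show ?thesis by simp
  next
    case True
    have fin: "finite S" using True insert by simp
    have SU: "S - {b} \<times> UNIV = A \<times> UNIV" "{b} \<times> UNIV \<in> Pow S" using True insert by auto
    have "coeff (bilin b b * tau_even A) S = (\<Sum>U\<in>{{b} \<times> UNIV}.
        (-1) ^ inv_count U (S - U) * coeff (bilin b b) U * coeff (tau_even A) (S - U))"
      unfolding times_even_grass.rep_eq gmul_def if_P[OF fin]
      by (rule sum.mono_neutral_right) (use fin SU in \<open>auto simp: coeff_bilin_diag\<close>)
    also have "\<dots> = 1"
      using even_inv_count_pair[OF insert(1,2)] by (simp add: SU coeff_bilin_diag insert.IH)
    finally show ?thesis using True tau by simp
  qed
qed simp

text \<open>The strict bound holds for the zero element even with n = 0, where the induction over
  disjoint blocks starts.\<close>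

definition deg_less :: "nat \<Rightarrow> 'v::linorder even_grass \<Rightarrow> bool" where
  "deg_less n X \<longleftrightarrow> (\<forall>S. coeff X S \<noteq> 0 \<longrightarrow> card S < n)"

text \<open>The successor makes the first bound a weak one: at most m plus less than n is less than
  m + n.\<close>

lemma deg_less_mult: "deg_less (Suc m) X \<Longrightarrow> deg_less n Y \<Longrightarrow> deg_less (m + n) (X * Y)"
  unfolding deg_less_def
proof (intro allI impI)
  fix S assume X: "\<forall>S. coeff X S \<noteq> 0 \<longrightarrow> card S < Suc m" and Y: "\<forall>S. coeff Y S \<noteq> 0 \<longrightarrow> card S < n"
    and "coeff (X * Y) S \<noteq> 0"
  from this(3) obtain U W where "coeff X U \<noteq> 0" "coeff Y W \<noteq> 0" "card S = card U + card W"
    by (rule coeff_mult_nonzeroE)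
  with X Y have "card U < Suc m" "card W < n" by blast+
  then show "card S < m + n" using \<open>card S = _\<close> by linarith
qed

lemma deg_less_add: "deg_less n X \<Longrightarrow> deg_less n Y \<Longrightarrow> deg_less n (X + Y)"
  unfolding deg_less_def by (metis add.right_neutral coeff_add)

lemma deg_less_const_mult: "deg_less n X \<Longrightarrow> deg_less n (const c * X)"
  unfolding deg_less_def by simp

lemma deg_less_leI: "deg_less m X \<Longrightarrow> m \<le> n \<Longrightarrow> deg_less n X"
  unfolding deg_less_def by fastforce

lemma deg_less_prod:
  assumes "\<And>i. i \<in> I \<Longrightarrow> deg_less (Suc m) (f i)"
  shows "deg_less (Suc (card I * m)) (prod f I)"
  using assms
proof (induction I rule: infinite_finite_induct)
  case (insert a I)
  then have "deg_less (m + Suc (card I * m)) (f a * prod f I)" by (intro deg_less_mult) auto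
  with insert show ?case by simp
qed (auto simp: deg_less_def)

lemma deg_less_diff_bilin: "deg_less 3 (diff_bilin i a)"
  unfolding deg_less_def
proof (intro allI impI)
  fix S assume "coeff (diff_bilin i a) S \<noteq> 0"
  then have "coeff (bilin i i) S \<noteq> 0 \<or> coeff (bilin a a) S \<noteq> 0 \<or> coeff (bilin i a) S \<noteq> 0 \<or> coeff (bilin a i) S \<noteq> 0"
    by (auto simp: diff_bilin_def)
  then show "card S < 3" using card_of_coeff_bilin by fastforce
qed

text \<open>The rooted form has \<open>card A - 1\<close> factors, each of degree at most 2. Within
  a hyperedge element only tau can therefore reach degree 2 |A|.\<close>

lemma deg_less_core:
  assumes "finite A" "A \<noteq> {}"
  shows "deg_less (Suc (2 * (card A - 1))) (core A)"
proof -
  obtain a where a: "a \<in> A" using assms by auto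
  have "deg_less (Suc (card (A - {a}) * 2)) (\<Prod>i\<in>A - {a}. diff_bilin i a)"
    by (rule deg_less_prod) (use deg_less_diff_bilin in \<open>simp add: numeral_eq_Suc\<close>)
  then show ?thesis using assms a by (simp add: core_eq_prod[OF assms(1) a] mult.commute)
qed

lemma deg_less_tau_even: "finite A \<Longrightarrow> deg_less (Suc (2 * card A)) (tau_even A)"
  by (auto simp: deg_less_def coeff_tau_even card_cartesian_product split: if_splits)

text \<open>Each factor is a multiple of tau plus terms of lower degree. The taus of disjoint sets
  multiply to the tau of the union, and every other product stays below the top degree.\<close>

lemma coeff_prod_hyperedge_elem:
  fixes K :: "'v::linorder set set"
  assumes "finite K" "\<And>C. C \<in> K \<Longrightarrow> finite C \<and> C \<noteq> {}"
    "\<And>C D. C \<in> K \<Longrightarrow> D \<in> K \<Longrightarrow> C \<noteq> D \<Longrightarrow> C \<inter> D = {}"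
  shows "coeff (\<Prod>C\<in>K. hyperedge_elem C (s C)) (\<Union>K \<times> UNIV) = (\<Prod>C\<in>K. s C)"
proof -
  have "\<exists>R. (\<Prod>C\<in>K. hyperedge_elem C (s C)) = const (\<Prod>C\<in>K. s C) * tau_even (\<Union>K) + R
      \<and> deg_less (2 * card (\<Union>K)) R"
    using assms
  proof (induction K rule: finite_induct)
    case empty
    then show ?case by (intro exI[of _ 0]) (simp add: deg_less_def)
  next
    case (insert C K)
    obtain R where R: "(\<Prod>C\<in>K. hyperedge_elem C (s C)) = const (\<Prod>C\<in>K. s C) * tau_even (\<Union>K) + R"
      "deg_less (2 * card (\<Union>K)) R"
      using insert by force
    define U where "U = \<Union>K"
    have fin: "finite C" "C \<noteq> {}" "finite U" and disj: "C \<inter> U = {}"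
      using insert by (auto simp: U_def)
    have cU: "card (C \<union> U) = card C + card U" using fin disj by (simp add: card_Un_disjoint)
    \<comment> \<open>For nonempty \<open>C\<close> the truncated \<open>card C - 1\<close> is a
      true decrease, on which the bound for \<open>core C * tau_even U\<close> relies.\<close>
    have cC: "card C > 0" using fin by (simp add: card_gt_0_iff)
    let ?p = "\<Prod>C\<in>K. s C"
    \<comment> \<open>All products other than tau times tau. Each contains \<open>core C\<close> or
      \<open>R\<close> and so falls short of the full degree.\<close>
    define R' where "R' = const ?p * (core C * tau_even U) + core C * R + const (s C) * (tau_even C * R)"
    have "deg_less (2 * (card C - 1) + Suc (2 * card U)) (core C * tau_even U)"
      by (intro deg_less_mult deg_less_core deg_less_tau_even fin)
    then have 1: "deg_less (2 * card (C \<union> U)) (const ?p * (core C * tau_even U))"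
      by (intro deg_less_const_mult) (erule deg_less_leI, use cU cC in auto)
    have "deg_less (2 * (card C - 1) + 2 * card U) (core C * R)"
      using R(2) unfolding U_def[symmetric] by (intro deg_less_mult deg_less_core fin)
    then have 2: "deg_less (2 * card (C \<union> U)) (core C * R)"
      by (rule deg_less_leI) (use cU in auto)
    have "deg_less (2 * card C + 2 * card U) (tau_even C * R)"
      using R(2) unfolding U_def[symmetric] by (intro deg_less_mult deg_less_tau_even fin)
    then have 3: "deg_less (2 * card (C \<union> U)) (const (s C) * (tau_even C * R))"
      by (intro deg_less_const_mult) (simp add: cU)
    have "(\<Prod>C\<in>insert C K. hyperedge_elem C (s C)) = const (\<Prod>C\<in>insert C K. s C) * tau_even (\<Union>(insert C K)) + R'"
      using insert(1,2) fin disj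
      by (simp add: R(1) hyperedge_elem_def[of C] R'_def U_def[symmetric] const_mult tau_even_Un_disjoint algebra_simps)
    moreover have "deg_less (2 * card (\<Union>(insert C K))) R'"
      unfolding R'_def using 1 2 3 by (simp add: U_def[symmetric] deg_less_add)
    ultimately show ?case by blast
  qed
  then obtain R where R: "(\<Prod>C\<in>K. hyperedge_elem C (s C)) = const (\<Prod>C\<in>K. s C) * tau_even (\<Union>K) + R"
    "deg_less (2 * card (\<Union>K)) R" by blast
  have "coeff R (\<Union>K \<times> UNIV) = 0"
    using R(2) by (force simp: deg_less_def card_cartesian_product)
  moreover have "finite (\<Union>K)" using assms by auto
  ultimately show ?thesis by (simp add: R(1) coeff_tau_even)
qed

section \<open>The exponential of a sum of square-zero elements\<close>

text \<open>Multinomial expansion: a monomial with a repeated factor vanishes, and each set of k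
  distinct factors arises from its k! orderings.\<close>

lemma power_sum_square_zero:
  fixes x :: "'i \<Rightarrow> 'r::comm_ring_1"
  assumes "finite I" "\<And>a. a \<in> I \<Longrightarrow> x a * x a = 0"
  shows "(\<Sum>a\<in>I. x a) ^ k = of_nat (fact k) * (\<Sum>T | T \<subseteq> I \<and> card T = k. \<Prod>a\<in>T. x a)"
  using assms
proof (induction I arbitrary: k rule: finite_induct)
  case empty
  have sub: "{T. T \<subseteq> {} \<and> card T = k} = (if k = 0 then {{}} else {})" by auto
  show ?case unfolding sub by (cases k) simp_all
next
  case (insert b I)
  let ?s = "sum x I" and ?e = "\<lambda>k. \<Sum>T | T \<subseteq> I \<and> card T = k. \<Prod>a\<in>T. x a"
  \<comment> \<open>As \<open>x b\<close> squares to zero, the binomial expansion stops after the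
    linear term.\<close>
  have pow: "(x b + ?s) ^ Suc k = ?s ^ Suc k + of_nat (Suc k) * x b * ?s ^ k" for k
  proof (induction k)
    case (Suc k)
    have "(x b + ?s) ^ Suc (Suc k) = (x b + ?s) * (?s ^ Suc k + of_nat (Suc k) * x b * ?s ^ k)"
      by (simp only: power_Suc[of _ "Suc k"] Suc.IH)
    also have "\<dots> = ?s ^ Suc (Suc k) + of_nat (Suc (Suc k)) * x b * ?s ^ Suc k
        + (x b * x b) * (of_nat (Suc k) * ?s ^ k)"
      by (simp add: algebra_simps)
    finally show ?case using insert.prems[of b] by simp
  qed simp
  show ?case
  proof (cases k)
    case 0
    have "{T. T \<subseteq> insert b I \<and> card T = 0} = {{}}"
      using insert.hyps finite_subset[of _ "insert b I"] by auto
    then show ?thesis using 0 by simp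
  next
    case (Suc m)
    have fT: "finite T" if "T \<subseteq> I" for T using that insert.hyps finite_subset by blast
    have split: "{T. T \<subseteq> insert b I \<and> card T = Suc m} =
        {T. T \<subseteq> I \<and> card T = Suc m} \<union> insert b ` {T. T \<subseteq> I \<and> card T = m}"
    proof (intro equalityI subsetI)
      fix T assume T: "T \<in> {T. T \<subseteq> insert b I \<and> card T = Suc m}"
      show "T \<in> {T. T \<subseteq> I \<and> card T = Suc m} \<union> insert b ` {T. T \<subseteq> I \<and> card T = m}"
      proof (cases "b \<in> T")
        case True
        then have "T = insert b (T - {b})" "T - {b} \<subseteq> I" "card (T - {b}) = m" using T by auto
        then show ?thesis by blast
      qed (use T in auto)
    qed (use insert.hyps fT in \<open>auto simp: card_insert_if\<close>)
    have inj: "inj_on (insert b) {T. T \<subseteq> I \<and> card T = m}"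
      using insert.hyps by (intro inj_onI) (metis (mono_tags, lifting) insert_ident mem_Collect_eq subsetD)
    have "(\<Sum>T | T \<subseteq> insert b I \<and> card T = Suc m. \<Prod>a\<in>T. x a) =
        ?e (Suc m) + (\<Sum>T\<in>insert b ` {T. T \<subseteq> I \<and> card T = m}. \<Prod>a\<in>T. x a)"
      unfolding split by (rule sum.union_disjoint) (use insert.hyps in auto)
    also have "(\<Sum>T\<in>insert b ` {T. T \<subseteq> I \<and> card T = m}. \<Prod>a\<in>T. x a) =
        (\<Sum>T | T \<subseteq> I \<and> card T = m. x b * (\<Prod>a\<in>T. x a))"
      unfolding sum.reindex[OF inj] o_def
      by (rule sum.cong) (use insert.hyps fT in \<open>auto intro!: prod.insert\<close>)
    also have "\<dots> = x b * ?e m" by (simp add: sum_distrib_left)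
    finally have e: "(\<Sum>T | T \<subseteq> insert b I \<and> card T = Suc m. \<Prod>a\<in>T. x a) = ?e (Suc m) + x b * ?e m" .
    have IH: "?s ^ k = of_nat (fact k) * ?e k" for k
      by (rule insert.IH) (use insert.prems in auto)
    have "(x b + ?s) ^ Suc m = of_nat (fact (Suc m)) * ?e (Suc m) + of_nat (Suc m) * x b * (of_nat (fact m) * ?e m)"
      by (simp only: pow IH)
    also have "\<dots> = of_nat (fact (Suc m)) * (?e (Suc m) + x b * ?e m)"
      by (simp add: algebra_simps)
    finally show ?thesis using insert.hyps Suc e by simp
  qed
qed

lemma gpow_coeff: "gpow (coeff X) n = coeff (X ^ n)"
  by (induction n) (simp_all add: gpow_def one_even_grass.rep_eq times_even_grass.rep_eq)

lemma gexp_nilpotent: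
  "coeff X {} = 0 \<Longrightarrow> gexp V (coeff X) S = (\<Sum>k\<le>2 * card V. coeff (X ^ k) S / of_nat (fact k))"
  by (simp add: gexp_def gadd_def gscale_def gpow_coeff)

text \<open>A factor with zero body contributes at least one generator to every monomial. This
  bounds the size of the subsets that matter in the truncated exponential.\<close>

lemma coeff_prod_eq_0:
  assumes "\<And>a. a \<in> T \<Longrightarrow> coeff (x a) {} = 0" "card S < card T"
  shows "coeff (\<Prod>a\<in>T. x a) S = 0"
  using assms
proof (induction T arbitrary: S rule: infinite_finite_induct)
  case (insert b T)
  show ?case
  proof (rule ccontr)
    assume "\<not> ?thesis"
    then have "coeff (x b * (\<Prod>a\<in>T. x a)) S \<noteq> 0" using insert.hyps by simp
    then obtain U W where UW: "coeff (x b) U \<noteq> 0" "coeff (\<Prod>a\<in>T. x a) W \<noteq> 0" "card S = card U + card W"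
      by (rule coeff_mult_nonzeroE)
    have "card U > 0"
      using UW(1) insert.prems(1)[of b] coeff_nonzero_finite by (auto simp: card_gt_0_iff)
    moreover have "card T \<le> card W"
      using insert.IH[of W] UW(2) insert.prems(1) by (metis insertCI not_le_imp_less)
    ultimately show False using insert.prems(2) insert.hyps UW(3) by simp
  qed
qed auto

text \<open>The k! from the power cancels against the exponential series. Summing over k then leaves
  all subsets of \<open>I\<close>, which is the expansion of the product.\<close>

lemma gexp_sum_square_zero:
  assumes "finite I" "\<And>a. a \<in> I \<Longrightarrow> x a * x a = 0" "\<And>a. a \<in> I \<Longrightarrow> coeff (x a) {} = 0"
    "card S \<le> 2 * card V"
  shows "gexp V (coeff (\<Sum>a\<in>I. x a)) S = coeff (\<Prod>a\<in>I. 1 + x a) S"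
proof -
  let ?X = "\<Sum>a\<in>I. x a"
  have "coeff ?X {} = 0" using assms(3) by simp
  then have "gexp V (coeff ?X) S = (\<Sum>k\<le>2 * card V. coeff (?X ^ k) S / of_nat (fact k))"
    by (rule gexp_nilpotent)
  also have "\<dots> = (\<Sum>k\<le>2 * card V. \<Sum>T | T \<subseteq> I \<and> card T = k. coeff (\<Prod>a\<in>T. x a) S)"
    by (rule sum.cong[OF refl], subst power_sum_square_zero[OF assms(1,2)], assumption)
      (simp del: of_nat_fact)
  also have "\<dots> = (\<Sum>T\<in>(\<Union>k\<in>{..2 * card V}. {T. T \<subseteq> I \<and> card T = k}). coeff (\<Prod>a\<in>T. x a) S)"
    by (rule sum.UNION_disjoint[symmetric]) (use assms(1) in auto)
  \<comment> \<open>The series stops at k = 2 |V|. A larger \<open>T\<close> contributes nothing,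
    since its product has no coefficient on so small an \<open>S\<close>.\<close>
  also have "\<dots> = (\<Sum>T\<in>Pow I. coeff (\<Prod>a\<in>T. x a) S)"
    by (rule sum.mono_neutral_left) (use assms in \<open>auto intro!: coeff_prod_eq_0\<close>)
  also have "\<dots> = coeff (\<Prod>a\<in>I. x a + 1) S"
    by (simp add: prod_add[OF assms(1)])
  finally show ?thesis by (simp add: add.commute)
qed

section \<open>Translation of the given coefficient functions into ring elements\<close>

lemma gadd_coeff: "gadd (coeff X) (coeff Y) = coeff (X + Y)"
  by (simp add: plus_even_grass.rep_eq)

lemma gscale_coeff: "gscale c (coeff X) = coeff (const c * X)"
  by (rule ext) (simp add: gscale_def)

lemma gsum_coeff: "(\<And>a. a \<in> I \<Longrightarrow> f a = coeff (g a)) \<Longrightarrow> gsum f I = coeff (sum g I)"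
  by (rule ext) (simp add: gsum_def)

lemma tau_eq_coeff:
  assumes "finite A" shows "tau A = coeff (tau_even A)"
proof -
  have "foldr (\<lambda>i acc. gmul (gmul (psibar i) (psi i)) acc) xs gone = coeff (\<Prod>i\<leftarrow>xs. bilin i i)" for xs :: "'a list"
    by (induction xs) (simp_all add: one_even_grass.rep_eq times_even_grass.rep_eq bilin.rep_eq)
  moreover have "(\<Prod>i\<leftarrow>sorted_list_of_set A. bilin i i) = tau_even A"
    using assms by (simp add: tau_even_def prod.distinct_set_conv_list[symmetric])
  ultimately show ?thesis by (simp add: tau_def)
qed

lemma fA_eq_coeff:
  assumes "finite A"
  shows "fA l A = coeff (hyperedge_elem A (l * (1 - of_nat (card A))))"
proof -
  let ?P = "{(i, j). i \<in> A \<and> j \<in> A \<and> i \<noteq> j}"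
  let ?b = "\<lambda>(i, j). bilin i j * tau_even (A - {i, j})"
  have "gsum (\<lambda>i. tau (A - {i})) A = coeff (\<Sum>i\<in>A. tau_even (A - {i}))"
    by (rule gsum_coeff) (use assms in \<open>simp add: tau_eq_coeff\<close>)
  moreover have "gsum (\<lambda>(i, j). gmul (gmul (psibar i) (psi j)) (tau (A - {i, j}))) ?P = coeff (sum ?b ?P)"
    by (rule gsum_coeff) (use assms in \<open>auto simp: tau_eq_coeff times_even_grass.rep_eq bilin.rep_eq\<close>)
  moreover have "sum ?b ?P = (\<Sum>i\<in>A. \<Sum>j\<in>A - {i}. bilin i j * tau_even (A - {i, j}))"
  proof -
    have "?P = (SIGMA i:A. A - {i})" by auto
    then show ?thesis using assms by (simp add: sum.Sigma)
  qed
  ultimately have "fA l A = coeff (const (l * (1 - of_nat (card A))) * tau_even A + (\<Sum>i\<in>A. tau_even (A - {i}))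
      + const (-1) * (\<Sum>i\<in>A. \<Sum>j\<in>A - {i}. bilin i j * tau_even (A - {i, j})))"
    unfolding fA_def by (simp only: tau_eq_coeff[OF assms] gscale_coeff gadd_coeff)
  also have "\<dots> = coeff (hyperedge_elem A (l * (1 - of_nat (card A))))"
    by (rule ext) (simp add: hyperedge_elem_def core_def sum_subtractf)
  finally show ?thesis .
qed

text \<open>Two vertices leave at least one factor \<open>diff_bilin b a\<close>, whose body is
  zero; for a singleton \<open>core\<close> is 1.\<close>

lemma coeff_hyperedge_elem_empty:
  assumes "finite A" "card A \<ge> 2"
  shows "coeff (hyperedge_elem A c) {} = 0"
proof -
  obtain a where a: "a \<in> A" using assms by fastforce
  have "card (A - {a}) \<noteq> 0" using assms a by simp
  then have "A - {a} \<noteq> {}" by (metis card.empty)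
  then obtain b where b: "b \<in> A - {a}" by blast
  have "core A = diff_bilin b a * (\<Prod>i\<in>A - {a} - {b}. diff_bilin i a)"
    unfolding core_eq_prod[OF assms(1) a] using assms b by (intro prod.remove) auto
  then have "coeff (core A) {} = 0" by (simp add: coeff_mult_empty diff_bilin_def)
  moreover have "coeff (tau_even A) {} = 0" using assms a by (auto simp: coeff_tau_even)
  ultimately show ?thesis by (simp add: hyperedge_elem_def)
qed

text \<open>\<open>A\<close> absorbs the blocks one at a time. Those already absorbed are disjoint
  from the next one, so the enlarged set still meets it in a single vertex.\<close>

lemma hyperedge_elem_mult_prod:
  assumes "finite K" "finite A" "\<And>C. C \<in> K \<Longrightarrow> finite C"
    "\<And>C D. C \<in> K \<Longrightarrow> D \<in> K \<Longrightarrow> C \<noteq> D \<Longrightarrow> C \<inter> D = {}"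
    "\<And>C. C \<in> K \<Longrightarrow> \<exists>a. A \<inter> C = {a}"
  shows "hyperedge_elem A c * (\<Prod>C\<in>K. hyperedge_elem C (s C)) = hyperedge_elem (A \<union> \<Union>K) (c + sum s K)"
  using assms
proof (induction K rule: finite_induct)
  case (insert C K)
  obtain a where a: "A \<inter> C = {a}" using insert.prems(4) by blast
  have disj: "C \<inter> \<Union>K = {}" using insert.hyps insert.prems(3) by auto
  have "hyperedge_elem A c * (\<Prod>C\<in>insert C K. hyperedge_elem C (s C)) =
      (hyperedge_elem A c * (\<Prod>C\<in>K. hyperedge_elem C (s C))) * hyperedge_elem C (s C)"
    using insert.hyps by (simp add: mult_ac)
  also have "\<dots> = hyperedge_elem (A \<union> \<Union>K) (c + sum s K) * hyperedge_elem C (s C)"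
    using insert.IH insert.prems by simp
  also have "\<dots> = hyperedge_elem (A \<union> \<Union>K \<union> C) (c + sum s K + s C)"
  proof (rule hyperedge_elem_mult_one)
    show "(A \<union> \<Union>K) \<inter> C = {a}" using a disj by blast
  qed (use insert.hyps insert.prems in auto)
  finally show ?case using insert.hyps by (simp add: Un_ac add_ac)
qed simp

section \<open>Hyperforests and their components\<close>

lemma joined_refl [simp]: "joined F u u"
  by (simp add: joined_def)

lemma joined_trans: "joined F u v \<Longrightarrow> joined F v w \<Longrightarrow> joined F u w"
  unfolding joined_def by (rule rtranclp_trans)

lemma joined_sym: "joined F u v \<Longrightarrow> joined F v u"
  unfolding joined_def by (rule sympD[OF symp_rtranclp]) (auto intro: sympI)

lemma joined_edge: "A \<in> F \<Longrightarrow> u \<in> A \<Longrightarrow> v \<in> A \<Longrightarrow> joined F u v"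
  unfolding joined_def by blast

lemma joined_mono: "joined F u v \<Longrightarrow> F \<subseteq> G \<Longrightarrow> joined G u v"
  unfolding joined_def by (erule rtranclp_mono[THEN predicate2D, rotated]) blast

lemma joined_empty: "joined {} u v \<longleftrightarrow> u = v"
  unfolding joined_def by (auto elim: rtranclp.cases)

text \<open>A walk may use \<open>A\<close> repeatedly, but everything between its first entry into
  \<open>A\<close> and its last exit can be replaced by one step through \<open>A\<close>.\<close>

lemma joined_insert:
  "joined (insert A F) u v \<longleftrightarrow> joined F u v \<or> (\<exists>a\<in>A. \<exists>b\<in>A. joined F u a \<and> joined F b v)"
proof
  assume "joined (insert A F) u v"
  then show "joined F u v \<or> (\<exists>a\<in>A. \<exists>b\<in>A. joined F u a \<and> joined F b v)"
    unfolding joined_def[of "insert A F"]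
  proof (induction rule: rtranclp_induct)
    case (step x y)
    from step.hyps(2) consider "x \<in> A" "y \<in> A" | "joined F x y"
      by (auto intro: joined_edge)
    then show ?case
    proof cases
      case 1
      then have "\<exists>a\<in>A. joined F u a" using step.IH by auto
      then show ?thesis using 1(2) joined_refl[of F y] by blast
    next
      case 2
      then show ?thesis using step.IH joined_trans[OF _ 2] by auto
    qed
  qed simp
next
  assume "joined F u v \<or> (\<exists>a\<in>A. \<exists>b\<in>A. joined F u a \<and> joined F b v)"
  then show "joined (insert A F) u v"
    by (meson joined_edge joined_mono joined_trans insertI1 subset_insertI)
qed

lemma is_cycle_mono: "is_cycle F vs es \<Longrightarrow> set es \<subseteq> G \<Longrightarrow> is_cycle G vs es"
  unfolding is_cycle_def by (auto simp: subset_iff)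

lemma hyperforest_empty: "hyperforest {}"
  by (fastforce simp: hyperforest_def is_cycle_def)

lemma joined_along:
  assumes "\<And>j. m \<le> j \<Longrightarrow> j < n \<Longrightarrow> es j \<in> F \<and> f j \<in> es j \<and> f (Suc j) \<in> es j" "m \<le> n"
  shows "joined F (f m) (f n)"
  using assms(2,1)
proof (induction n rule: dec_induct)
  case (step n)
  then have "joined F (f m) (f n)" "joined F (f n) (f (Suc n))"
    by (auto intro: joined_edge[of "es n"])
  then show ?case by (rule joined_trans)
qed simp

text \<open>Opened at \<open>A\<close>, the cycle becomes a walk in \<open>F\<close> from the vertex
  after \<open>A\<close>, through v_k = v_0, to the vertex before \<open>A\<close>.\<close>

lemma cycle_through_new_edge:
  assumes "is_cycle (insert A F) vs es" "A \<in> set es"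
  obtains u v where "u \<in> A" "v \<in> A" "u \<noteq> v" "joined F u v"
proof -
  let ?k = "length es"
  have cyc: "length vs = ?k + 1" "?k \<ge> 2" "distinct (butlast vs)" "last vs = hd vs" "distinct es"
    "\<And>i. i < ?k \<Longrightarrow> es ! i \<in> insert A F \<and> vs ! i \<in> es ! i \<and> vs ! Suc i \<in> es ! i"
    using assms(1) by (auto simp: is_cycle_def)
  obtain i where i: "i < ?k" "es ! i = A" using assms(2) by (auto simp: in_set_conv_nth)
  have other: "es ! j \<in> F" if "j < ?k" "j \<noteq> i" for j
    using cyc(6)[OF that(1)] that i cyc(5) by (auto simp: nth_eq_iff_index_eq)
  have vk: "vs ! ?k = vs ! 0"
    using cyc(1,4) by (metis Suc_eq_plus1 diff_Suc_1 hd_conv_nth last_conv_nth length_0_conv nat.simps(3))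
  have dist: "vs ! a \<noteq> vs ! b" if "a < ?k" "b < ?k" "a \<noteq> b" for a b
    using that cyc(1,3) nth_eq_iff_index_eq[OF cyc(3), of a b] by (simp add: nth_butlast)
  \<comment> \<open>Distinctness covers only v_0 to v_(k-1). If \<open>A\<close> is the last
    hyperedge, then v_k = v_0 still differs from v_(k-1) because k is at least 2.\<close>
  have neq: "vs ! i \<noteq> vs ! Suc i"
  proof (cases "Suc i = ?k")
    case True
    then have "i \<noteq> 0" "0 < ?k" using cyc(2) by linarith+
    then show ?thesis using dist[OF i(1)] vk True by metis
  next
    case False
    then show ?thesis using dist[of i "Suc i"] i by auto
  qed
  have "joined F (vs ! Suc i) (vs ! ?k)"
    by (rule joined_along[of _ _ "(!) es"]) (use cyc(6) other i in auto)
  moreover have "joined F (vs ! 0) (vs ! i)"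
    by (rule joined_along[of _ _ "(!) es"]) (use cyc(6) other i in auto)
  ultimately have "joined F (vs ! Suc i) (vs ! i)"
    unfolding vk by (rule joined_trans)
  then show ?thesis
    using cyc(6)[OF i(1)] neq i(2) by (intro that[of "vs ! Suc i" "vs ! i"]) auto
qed

text \<open>A shortest walk from \<open>u\<close> to \<open>v\<close> repeats neither a vertex nor a hyperedge, so \<open>A\<close> closes it up
  to a cycle.\<close>

lemma cycle_of_joined:
  assumes "joined F u v" "u \<noteq> v" "u \<in> A" "v \<in> A" "A \<notin> F"
  shows "\<exists>vs es. is_cycle (insert A F) vs es"
proof -
  let ?r = "\<lambda>x y. \<exists>B\<in>F. x \<in> B \<and> y \<in> B"
  have "\<exists>n. (?r ^^ n) u v"
    using assms(1) unfolding joined_def by (rule rtranclp_imp_relpowp)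
  then obtain n where n: "(?r ^^ n) u v" and min: "\<And>m. m < n \<Longrightarrow> \<not> (?r ^^ m) u v"
    using exists_least_iff[of "\<lambda>n. (?r ^^ n) u v"] by blast
  obtain f where f: "f 0 = u" "f n = v" "\<And>i. i < n \<Longrightarrow> ?r (f i) (f (Suc i))"
    using n unfolding relpowp_fun_conv by blast
  obtain e where e: "\<And>i. i < n \<Longrightarrow> e i \<in> F \<and> f i \<in> e i \<and> f (Suc i) \<in> e i"
    using f(3) by metis
  have seg: "(?r ^^ (j - i)) (f i) (f j)" if "i \<le> j" "j \<le> n" for i j
    unfolding relpowp_fun_conv
    by (rule exI[of _ "\<lambda>k. f (i + k)"]) (use f(3) that in auto)
  \<comment> \<open>A shorter link between two vertices of the walk would shorten the whole walk
    from u to v.\<close>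
  have short: "\<not> (?r ^^ m) (f i) (f j)" if "i \<le> j" "j \<le> n" "m < j - i" for i j m
  proof
    assume m: "(?r ^^ m) (f i) (f j)"
    have "(?r ^^ i) u (f i)" "(?r ^^ (n - j)) (f j) v"
      using seg[of 0 i] seg[of j n] that f(1,2) by auto
    then have "(?r ^^ (i + m + (n - j))) u v"
      unfolding relpowp_add using m by blast
    moreover have "i + m + (n - j) < n" using that by linarith
    ultimately show False using min by blast
  qed
  have inj_f: "f i \<noteq> f j" if "i < j" "j \<le> n" for i j
    using short[of i j 0] that by auto
  \<comment> \<open>A hyperedge used at steps i and j would allow a single step from
    \<open>f i\<close> to \<open>f (Suc j)\<close>.\<close>
  have inj_e: "e i \<noteq> e j" if "i < j" "j < n" for i j
  proof
    assume "e i = e j"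
    then have "?r (f i) (f (Suc j))" using e[of i] e[of j] that by auto
    then have "(?r ^^ 1) (f i) (f (Suc j))" by (simp only: relpowp_1)
    moreover have "1 < Suc j - i" using that by linarith
    ultimately show False using short[of i "Suc j" 1] that by simp
  qed
  \<comment> \<open>A walk of at least one step, together with \<open>A\<close>, has the two
    hyperedges that a cycle requires.\<close>
  have n0: "n \<noteq> 0" using f(1,2) assms(2) by metis
  define vs where "vs = map f [0..<Suc n] @ [u]"
  define es where "es = map e [0..<n] @ [A]"
  have "is_cycle (insert A F) vs es"
    unfolding is_cycle_def
  proof (intro conjI allI impI)
    have "inj_on f {0..<Suc n}"
      by (rule linorder_inj_onI') (use inj_f in auto)
    then show "distinct (butlast vs)" unfolding vs_def by (simp add: distinct_map del: upt_Suc)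
    have "inj_on e {0..<n}" by (rule linorder_inj_onI') (use inj_e in auto)
    then show "distinct es" using e assms(5) by (auto simp: es_def distinct_map)
    show "last vs = hd vs" using f(1) by (simp add: vs_def hd_append upt_conv_Cons del: upt_Suc)
    fix i assume "i < length es"
    then consider "i < n" | "i = n" by (fastforce simp: es_def)
    then have "es ! i \<in> insert A F \<and> vs ! i \<in> es ! i \<and> vs ! (i + 1) \<in> es ! i"
    proof cases
      case 1
      then show ?thesis using e[of i] by (simp add: vs_def es_def nth_append del: upt_Suc)
    next
      case 2
      then show ?thesis using f(2) assms by (simp add: vs_def es_def nth_append del: upt_Suc)
    qed
    then show "es ! i \<in> insert A F" "vs ! i \<in> es ! i" "vs ! (i + 1) \<in> es ! i" by auto
  qed (use n0 in \<open>auto simp: vs_def es_def\<close>)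
  then show ?thesis by blast
qed

text \<open>Turns acyclicity into connectivity, so that forests can be treated by adding one
  hyperedge at a time. A cycle either avoids \<open>A\<close> or, opened at \<open>A\<close>, joins
  two of its vertices within \<open>F\<close>.\<close>

lemma hyperforest_insert:
  assumes "A \<notin> F"
  shows "hyperforest (insert A F) \<longleftrightarrow> hyperforest F \<and> (\<forall>u\<in>A. \<forall>v\<in>A. joined F u v \<longrightarrow> u = v)"
proof (intro iffI conjI ballI impI)
  assume hf: "hyperforest (insert A F)"
  have "is_cycle (insert A F) vs es" if "is_cycle F vs es" for vs es
    by (rule is_cycle_mono[OF that]) (use that in \<open>auto simp: is_cycle_def in_set_conv_nth\<close>)
  then show "hyperforest F" using hf by (auto simp: hyperforest_def)
  fix u v assume "u \<in> A" "v \<in> A" "joined F u v"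
  then show "u = v" using cycle_of_joined[of F u v A] assms hf by (auto simp: hyperforest_def)
next
  assume hf: "hyperforest F \<and> (\<forall>u\<in>A. \<forall>v\<in>A. joined F u v \<longrightarrow> u = v)"
  have False if "is_cycle (insert A F) vs es" for vs es
  proof (cases "A \<in> set es")
    case True
    from cycle_through_new_edge[OF that True] show False using hf by metis
  next
    case False
    have "is_cycle F vs es"
      by (rule is_cycle_mono[OF that]) (use that False in \<open>auto simp: is_cycle_def in_set_conv_nth\<close>)
    then show False using hf by (auto simp: hyperforest_def)
  qed
  then show "hyperforest (insert A F)" by (auto simp: hyperforest_def)
qed

section \<open>Components and the effect of a new hyperedge\<close>

lemma components_memD: "C \<in> components V F \<Longrightarrow> u \<in> C \<Longrightarrow> C = {v \<in> V. joined F u v}"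
  unfolding components_def using joined_sym[of F] joined_trans[of F] by fast

lemma components_disjoint:
  assumes "C \<in> components V F" "D \<in> components V F" "C \<noteq> D" shows "C \<inter> D = {}"
  using components_memD[OF assms(1)] components_memD[OF assms(2)] assms(3) by blast

lemma Union_components: "\<Union>(components V F) = V"
  by (auto simp: components_def)

lemma components_nonempty: "C \<in> components V F \<Longrightarrow> C \<noteq> {}"
  by (auto simp: components_def)

lemma components_subset: "C \<in> components V F \<Longrightarrow> C \<subseteq> V"
  by (auto simp: components_def)

lemma finite_components: "finite V \<Longrightarrow> finite (components V F)"
  by (simp add: components_def)

text \<open>For \<open>A \<subseteq> V\<close> these are the components of \<open>(V, F)\<close>
  that meet \<open>A\<close>. Written as an image of \<open>A\<close>, they can be counted by
  injectivity.\<close>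

definition touched :: "'v set \<Rightarrow> 'v set set \<Rightarrow> 'v set \<Rightarrow> 'v set set" where
  "touched V F A = (\<lambda>u. {v \<in> V. joined F u v}) ` A"

lemma touched_subset: "A \<subseteq> V \<Longrightarrow> touched V F A \<subseteq> components V F"
  by (auto simp: touched_def components_def)

lemma touched_iff:
  assumes "A \<subseteq> V" "C \<in> components V F"
  shows "C \<in> touched V F A \<longleftrightarrow> C \<inter> A \<noteq> {}"
proof
  assume "C \<in> touched V F A"
  then show "C \<inter> A \<noteq> {}" using assms(1) by (auto simp: touched_def)
next
  assume "C \<inter> A \<noteq> {}"
  then obtain u where "u \<in> A" "C = {v \<in> V. joined F u v}" using components_memD[OF assms(2)] by blast
  then show "C \<in> touched V F A" unfolding touched_def by blast
qed

lemma subset_Union_touched: "A \<subseteq> V \<Longrightarrow> A \<subseteq> \<Union>(touched V F A)"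
  by (auto simp: touched_def)

text \<open>A vertex joined to \<open>A\<close> now reaches everything that \<open>A\<close>
  reaches; no other vertex can make use of the new hyperedge.\<close>

lemma components_insert:
  assumes "A \<subseteq> V" "A \<noteq> {}"
  shows "components V (insert A F) = insert (\<Union>(touched V F A)) (components V F - touched V F A)"
proof -
  let ?cl = "\<lambda>G u. {v \<in> V. joined G u v}"
  have U: "\<Union>(touched V F A) = {v \<in> V. \<exists>b\<in>A. joined F b v}"
    by (auto simp: touched_def)
  have near: "?cl (insert A F) u = \<Union>(touched V F A)" if "a \<in> A" "joined F u a" for u a
    unfolding U joined_insert using that by (auto intro: joined_sym joined_trans)
  have far: "?cl (insert A F) u = ?cl F u" "?cl F u \<notin> touched V F A"
    if "u \<in> V" "\<not> (\<exists>a\<in>A. joined F u a)" for u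
  proof -
    show "?cl (insert A F) u = ?cl F u" unfolding joined_insert using that by auto
    have "?cl F u \<in> components V F" using that by (auto simp: components_def)
    then show "?cl F u \<notin> touched V F A" using touched_iff[OF assms(1)] that by blast
  qed
  show ?thesis
  proof (intro equalityI subsetI)
    fix C assume "C \<in> components V (insert A F)"
    then obtain u where u: "u \<in> V" "C = ?cl (insert A F) u" by (auto simp: components_def)
    show "C \<in> insert (\<Union>(touched V F A)) (components V F - touched V F A)"
    proof (cases "\<exists>a\<in>A. joined F u a")
      case True
      then show ?thesis using near u by blast
    next
      case False
      then have "C = ?cl F u" "C \<notin> touched V F A" using far u by auto
      moreover have "?cl F u \<in> components V F" using u by (auto simp: components_def)
      ultimately show ?thesis by blast
    qed
  next
    fix C assume C: "C \<in> insert (\<Union>(touched V F A)) (components V F - touched V F A)"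
    obtain a where a: "a \<in> A" using assms by auto
    have U: "\<Union>(touched V F A) \<in> components V (insert A F)"
      using near[OF a joined_refl] a assms(1) unfolding components_def by blast
    show "C \<in> components V (insert A F)"
    proof (cases "C = \<Union>(touched V F A)")
      case True
      show ?thesis unfolding True by (rule U)
    next
      case False
      then have C: "C \<in> components V F" "C \<notin> touched V F A" using C by auto
      obtain u where u: "u \<in> V" "C = ?cl F u" using C by (auto simp: components_def)
      have "\<not> (\<exists>a\<in>A. joined F u a)" using C(2) touched_iff[OF assms(1) C(1)] u assms(1) by blast
      then have "C = ?cl (insert A F) u" using far(1) u by blast
      then show ?thesis using u by (auto simp: components_def)
    qed
  qed
qed

text \<open>The hyperedge weight is kept general to cover both the parameters lambda_A (1 - |A|) of
  the theorem and the vertex count of a hypertree.\<close>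

definition comp_weight :: "('v \<Rightarrow> complex) \<Rightarrow> ('v set \<Rightarrow> complex) \<Rightarrow> 'v set set \<Rightarrow> 'v set \<Rightarrow> complex" where
  "comp_weight t c F C = (\<Sum>i\<in>C. t i) + (\<Sum>A\<in>comp_edges F C. c A)"

lemma comp_weight_insert_untouched:
  assumes "A \<subseteq> V" "A \<noteq> {}" "C \<in> components V F - touched V F A"
  shows "comp_weight t c (insert A F) C = comp_weight t c F C"
proof -
  have "C \<inter> A = {}" using touched_iff[OF assms(1)] assms(3) by blast
  then have "comp_edges (insert A F) C = comp_edges F C" using assms(2) by (auto simp: comp_edges_def)
  then show ?thesis by (simp add: comp_weight_def)
qed

text \<open>An old hyperedge inside the merged component lies in exactly one touched component: its
  own vertices are joined by it, and being nonempty it cannot lie in two disjoint sets. Both sums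
  therefore split, and only \<open>A\<close> is new.\<close>

lemma comp_weight_insert_touched:
  assumes "finite V" "finite F" "\<And>B. B \<in> F \<Longrightarrow> B \<noteq> {}" "A \<subseteq> V" "A \<notin> F"
  shows "comp_weight t c (insert A F) (\<Union>(touched V F A)) = c A + (\<Sum>C\<in>touched V F A. comp_weight t c F C)"
proof -
  let ?K = "touched V F A"
  have K: "?K \<subseteq> components V F" by (rule touched_subset) fact
  have fin: "finite ?K" using K finite_components[OF assms(1)] finite_subset by blast
  have finC: "finite C" if "C \<in> ?K" for C using that assms(1) by (auto simp: touched_def)
  have disj: "C \<inter> D = {}" if "C \<in> ?K" "D \<in> ?K" "C \<noteq> D" for C D
    using components_disjoint that K by blast
  have edges: "comp_edges (insert A F) (\<Union>?K) = insert A (\<Union>C\<in>?K. comp_edges F C)"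
  proof -
    have sub: "\<exists>C\<in>?K. B \<subseteq> C" if B: "B \<in> F" "B \<subseteq> \<Union>?K" for B
    proof -
      obtain x where x: "x \<in> B" using assms(3)[OF B(1)] by auto
      then obtain C where C: "C \<in> ?K" "x \<in> C" using B by blast
      have "C = {v \<in> V. joined F x v}" by (rule components_memD) (use C K in auto)
      moreover have "B \<subseteq> V" using B(2) by (auto simp: touched_def)
      ultimately have "B \<subseteq> C" using joined_edge[OF B(1) x] by auto
      then show ?thesis using C by blast
    qed
    show ?thesis
    proof (intro equalityI subsetI)
      fix B assume "B \<in> comp_edges (insert A F) (\<Union>?K)"
      then show "B \<in> insert A (\<Union>C\<in>?K. comp_edges F C)"
        using sub[of B] by (auto simp: comp_edges_def)
    qed (use subset_Union_touched[OF assms(4)] in \<open>auto simp: comp_edges_def\<close>)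
  qed
  have notin: "A \<notin> (\<Union>C\<in>?K. comp_edges F C)" using assms(5) by (auto simp: comp_edges_def)
  have fe: "finite (comp_edges F C)" for C using assms(2) by (auto simp: comp_edges_def)
  have "sum t (\<Union>?K) = (\<Sum>C\<in>?K. sum t C)"
    using finC disj by (subst sum.Union_disjoint) auto
  moreover have "sum c (\<Union>C\<in>?K. comp_edges F C) = (\<Sum>C\<in>?K. sum c (comp_edges F C))"
  proof (rule sum.UNION_disjoint[OF fin])
    show "\<forall>C\<in>?K. \<forall>D\<in>?K. C \<noteq> D \<longrightarrow> comp_edges F C \<inter> comp_edges F D = {}"
    proof (intro ballI impI equals0I)
      fix C D B assume "C \<in> ?K" "D \<in> ?K" "C \<noteq> D" "B \<in> comp_edges F C \<inter> comp_edges F D"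
      then have "B \<subseteq> C" "B \<subseteq> D" "B \<in> F" "C \<inter> D = {}" using disj[of C D] by (simp_all add: comp_edges_def)
      then show False using assms(3)[of B] by blast
    qed
  qed (use fe in auto)
  ultimately show ?thesis
    using fin fe notin unfolding comp_weight_def edges by (simp add: sum.distrib)
qed

text \<open>With these weights the claim reads \<open>|C| = 1 + (\<Sum>A. |A| - 1)\<close>, the sum being over the
  hyperedges of the component \<open>C\<close>.\<close>

lemma hyperforest_comp_weight:
  assumes "finite V" "finite F" "\<And>A. A \<in> F \<Longrightarrow> A \<subseteq> V \<and> A \<noteq> {}" "hyperforest F" "C \<in> components V F"
  shows "comp_weight (\<lambda>_. 1) (\<lambda>A. 1 - of_nat (card A)) F C = 1"
  using assms(2,3,4,5)
proof (induction F arbitrary: C rule: finite_induct)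
  case empty
  then obtain u where "u \<in> V" "C = {v \<in> V. u = v}" by (auto simp: components_def joined_empty)
  then have "C = {u}" by auto
  then show ?case by (simp add: comp_weight_def comp_edges_def)
next
  case (insert A F)
  have hf: "hyperforest F" and sep: "\<And>u v. u \<in> A \<Longrightarrow> v \<in> A \<Longrightarrow> joined F u v \<Longrightarrow> u = v"
    using insert.prems(2) hyperforest_insert[OF insert.hyps(2)] by auto
  have A: "A \<subseteq> V" "A \<noteq> {}" using insert.prems(1) by auto
  have IH: "comp_weight (\<lambda>_. 1) (\<lambda>A. 1 - of_nat (card A)) F C = 1" if "C \<in> components V F" for C
    using insert.IH[OF _ hf that] insert.prems(1) by simp
  from insert.prems(3) consider "C = \<Union>(touched V F A)" | "C \<in> components V F - touched V F A"
    unfolding components_insert[OF A] by blast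
  then show ?case
  proof cases
    case 1
    \<comment> \<open>No two vertices of \<open>A\<close> are joined in \<open>F\<close>, so
      \<open>A\<close> touches exactly |A| components. Each has weight 1 by induction, and the term
      1 - |A| of the new hyperedge brings the total back to 1.\<close>
    have "inj_on (\<lambda>u. {v \<in> V. joined F u v}) A"
    proof (rule inj_onI)
      fix u v assume uv: "u \<in> A" "v \<in> A" "{w \<in> V. joined F u w} = {w \<in> V. joined F v w}"
      have "v \<in> {w \<in> V. joined F v w}" using A uv(2) by auto
      then have "joined F u v" unfolding uv(3)[symmetric] by simp
      then show "u = v" using sep uv(1,2) by blast
    qed
    then have card: "card (touched V F A) = card A" unfolding touched_def by (rule card_image)
    have "(\<Sum>C\<in>touched V F A. comp_weight (\<lambda>_. 1) (\<lambda>A. 1 - of_nat (card A)) F C) = (\<Sum>C\<in>touched V F A. 1)"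
      by (rule sum.cong[OF refl], rule IH) (use touched_subset[OF A(1)] in blast)
    also have "\<dots> = of_nat (card A)" by (simp add: card)
    finally show ?thesis
      unfolding 1 using insert.hyps insert.prems(1) A
      by (subst comp_weight_insert_touched[OF assms(1)]) auto
  next
    case 2
    then show ?thesis using IH comp_weight_insert_untouched[OF A 2] by simp
  qed
qed

section \<open>Expansion over hyperforests\<close>

text \<open>Induction on \<open>F\<close> from the isolated vertices. If the new hyperedge meets
  some component in two vertices, it closes a cycle and the product becomes 0. Otherwise it meets
  each touched component in one vertex and merges their elements, adding the parameters.\<close>

lemma prod_hyperedge_elem_forest:
  assumes "finite V" "finite F" "\<And>A. A \<in> F \<Longrightarrow> A \<subseteq> V \<and> A \<noteq> {}"
  shows "(\<Prod>i\<in>V. hyperedge_elem {i} (t i)) * (\<Prod>A\<in>F. hyperedge_elem A (c A)) =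
    (if hyperforest F then \<Prod>C\<in>components V F. hyperedge_elem C (comp_weight t c F C) else 0)"
  using assms(2,3)
proof (induction F rule: finite_induct)
  case empty
  have "components V {} = (\<lambda>i. {i}) ` V"
    unfolding components_def joined_empty by (rule image_cong) auto
  then show ?case
    by (simp add: hyperforest_empty prod.reindex comp_weight_def comp_edges_def)
next
  case (insert A F)
  define P where "P = (\<Prod>i\<in>V. hyperedge_elem {i} (t i)) * (\<Prod>A\<in>F. hyperedge_elem A (c A))"
  let ?s = "comp_weight t c F" and ?s' = "comp_weight t c (insert A F)"
  let ?K = "touched V F A" and ?D = "components V F - touched V F A"
  have A: "A \<subseteq> V" "A \<noteq> {}" using insert.prems by auto
  have finA: "finite A" using A(1) assms(1) finite_subset by blast
  have finite_comp: "finite C" if "C \<in> components V F" for C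
    using components_subset[OF that] assms(1) finite_subset by blast
  have K: "?K \<subseteq> components V F" by (rule touched_subset) fact
  have finK: "finite ?K" and finD: "finite ?D"
    using K finite_components[OF assms(1), of F] finite_subset by auto
  have IH: "P = (if hyperforest F then \<Prod>C\<in>components V F. hyperedge_elem C (?s C) else 0)"
    unfolding P_def using insert.IH insert.prems by simp
  have step: "(\<Prod>i\<in>V. hyperedge_elem {i} (t i)) * (\<Prod>A\<in>insert A F. hyperedge_elem A (c A)) =
      hyperedge_elem A (c A) * P"
    using insert.hyps by (simp add: P_def mult_ac)
  consider "\<not> hyperforest F" | "hyperforest F" "\<not> hyperforest (insert A F)"
    | "hyperforest F" "hyperforest (insert A F)" by blast
  then show ?case
  proof cases
    case 1
    then have "\<not> hyperforest (insert A F)" by (simp add: hyperforest_insert insert.hyps)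
    with 1 show ?thesis unfolding step IH by simp
  next
    case 2
    then obtain u v where uv: "u \<in> A" "v \<in> A" "joined F u v" "u \<noteq> v"
      by (auto simp: hyperforest_insert insert.hyps)
    define C where "C = {w \<in> V. joined F u w}"
    have C: "C \<in> components V F" "u \<in> C" "v \<in> C"
      using uv A by (auto simp: C_def components_def)
    \<comment> \<open>The component containing both u and v is singled out, because its factor
      annihilates that of \<open>A\<close>.\<close>
    have "P = hyperedge_elem C (?s C) * (\<Prod>C\<in>components V F - {C}. hyperedge_elem C (?s C))"
      using 2 C finite_components[OF assms(1)] by (simp add: IH prod.remove[of _ C])
    moreover have "hyperedge_elem A (c A) * hyperedge_elem C (?s C) = 0"
      by (rule hyperedge_elem_mult_two[of _ _ u v]) (use finA finite_comp C uv in auto)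
    ultimately have "hyperedge_elem A (c A) * P = 0" by (simp flip: mult.assoc)
    then show ?thesis unfolding step using 2 by simp
  next
    case 3
    have sep: "u = v" if "u \<in> A" "v \<in> A" "joined F u v" for u v
      using that 3(2) by (auto simp: hyperforest_insert insert.hyps)
    have meet: "\<exists>a. A \<inter> C = {a}" if C: "C \<in> ?K" for C
    proof -
      obtain a where a: "a \<in> A" "C = {w \<in> V. joined F a w}" using C unfolding touched_def by blast
      then have "A \<inter> C = {a}" using sep A(1) by auto
      then show ?thesis ..
    qed
    \<comment> \<open>The touched components cover \<open>A\<close>, so merging yields exactly their
      union, which is the new component.\<close>
    have "A \<union> \<Union>?K = \<Union>?K" using subset_Union_touched[OF A(1)] by blast
    moreover have "hyperedge_elem A (c A) * (\<Prod>C\<in>?K. hyperedge_elem C (?s C)) =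
        hyperedge_elem (A \<union> \<Union>?K) (c A + sum ?s ?K)"
    proof (rule hyperedge_elem_mult_prod[OF finK finA])
      fix C D assume "C \<in> ?K" "D \<in> ?K" "C \<noteq> D"
      then show "C \<inter> D = {}" using components_disjoint[of C V F D] K by blast
    qed (use finite_comp K meet in blast)+
    moreover have "?s' (\<Union>?K) = c A + sum ?s ?K"
      by (rule comp_weight_insert_touched) (use assms(1) insert.hyps insert.prems A in auto)
    ultimately have merge: "hyperedge_elem A (c A) * (\<Prod>C\<in>?K. hyperedge_elem C (?s C)) =
        hyperedge_elem (\<Union>?K) (?s' (\<Union>?K))"
      by simp
    have new: "\<Union>?K \<notin> ?D"
    proof
      assume D: "\<Union>?K \<in> ?D"
      then have "\<Union>?K \<inter> A = {}" using touched_iff[OF A(1)] by blast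
      then show False using subset_Union_touched[OF A(1), of F] A(2) by blast
    qed
    have "components V F = ?K \<union> ?D" using K by blast
    then have "P = (\<Prod>C\<in>?K \<union> ?D. hyperedge_elem C (?s C))" using 3 IH by simp
    also have "\<dots> = (\<Prod>C\<in>?K. hyperedge_elem C (?s C)) * (\<Prod>C\<in>?D. hyperedge_elem C (?s C))"
      using finK finD by (intro prod.union_disjoint) auto
    finally have "hyperedge_elem A (c A) * P =
        hyperedge_elem (\<Union>?K) (?s' (\<Union>?K)) * (\<Prod>C\<in>?D. hyperedge_elem C (?s C))"
      by (simp add: merge flip: mult.assoc)
    also have "(\<Prod>C\<in>?D. hyperedge_elem C (?s C)) = (\<Prod>C\<in>?D. hyperedge_elem C (?s' C))"
      by (rule prod.cong[OF refl]) (simp add: comp_weight_insert_untouched[OF A])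
    also have "hyperedge_elem (\<Union>?K) (?s' (\<Union>?K)) * \<dots> =
        (\<Prod>C\<in>components V (insert A F). hyperedge_elem C (?s' C))"
      unfolding components_insert[OF A] by (rule prod.insert[OF finD new, symmetric])
    finally show ?thesis unfolding step using 3 by simp
  qed
qed

text \<open>The common form of both claims of the theorem, which differ only in how the component
  weight is evaluated.\<close>

lemma berezin_gexp_hypergraph:
  assumes "hypergraph V E"
  shows "berezin V (gexp V (gadd (gsum (\<lambda>i. gscale (t i) (gmul (psibar i) (psi i))) V)
      (gsum (\<lambda>A. gscale (w A) (fA (lam A) A)) E))) =
    (\<Sum>F\<in>spanning_hyperforests E. (\<Prod>A\<in>F. w A) *
      (\<Prod>C\<in>components V F. comp_weight t (\<lambda>A. lam A * (1 - of_nat (card A))) F C))"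
proof -
  define c where "c = (\<lambda>A. lam A * (1 - of_nat (card A)))"
  have finV: "finite V" and edge: "\<And>A. A \<in> E \<Longrightarrow> A \<subseteq> V \<and> card A \<ge> 2"
    using assms by (auto simp: hypergraph_def)
  have finE: "finite E" using edge finV by (meson Pow_iff finite_Pow_iff finite_subset subsetI)
  have finA: "finite A" if "A \<in> E" for A using edge[OF that] finV finite_subset by blast
  have finF: "finite F" if "F \<subseteq> E" for F using that finE finite_subset by blast
  \<comment> \<open>Vertex and hyperedge terms become one family over a disjoint sum, so that the
    exponential is factored in a single application.\<close>
  let ?x = "case_sum (\<lambda>i. const (t i) * bilin i i) (\<lambda>A. const (w A) * hyperedge_elem A (c A))"
  let ?S = "V \<times> (UNIV :: bool set)"
  let ?T = "\<Prod>i\<in>V. hyperedge_elem {i} (t i)"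
  have expo: "gadd (gsum (\<lambda>i. gscale (t i) (gmul (psibar i) (psi i))) V)
      (gsum (\<lambda>A. gscale (w A) (fA (lam A) A)) E) = coeff (\<Sum>a\<in>V <+> E. ?x a)"
  proof -
    have "gsum (\<lambda>i. gscale (t i) (gmul (psibar i) (psi i))) V = coeff (\<Sum>i\<in>V. const (t i) * bilin i i)"
      by (rule gsum_coeff) (simp add: bilin.rep_eq flip: gscale_coeff)
    moreover have "gsum (\<lambda>A. gscale (w A) (fA (lam A) A)) E =
        coeff (\<Sum>A\<in>E. const (w A) * hyperedge_elem A (c A))"
      by (rule gsum_coeff) (simp add: fA_eq_coeff finA c_def flip: gscale_coeff)
    ultimately show ?thesis
      by (simp add: gadd_coeff sum.Plus[OF finV finE] o_def)
  qed
  have sq: "?x a * ?x a = 0" if "a \<in> V <+> E" for a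
  proof (cases a)
    case (Inl i)
    have "?x a * ?x a = const (t i) * const (t i) * (bilin i i * bilin i i)"
      by (simp add: Inl mult_ac)
    then show ?thesis by (simp add: bilin_same_left)
  next
    case (Inr A)
    then have A: "A \<in> E" using that by auto
    have "\<not> card A \<le> 1" using edge[OF A] by simp
    then obtain u v where uv: "u \<in> A" "v \<in> A" "u \<noteq> v"
      using card_le_Suc0_iff_eq[OF finA[OF A]] by auto
    have "hyperedge_elem A (c A) * hyperedge_elem A (c A) = 0"
      by (rule hyperedge_elem_mult_two[of _ _ u v]) (use uv finA[OF A] in auto)
    moreover have "?x a * ?x a = const (w A) * const (w A) * (hyperedge_elem A (c A) * hyperedge_elem A (c A))"
      by (simp add: Inr mult_ac)
    ultimately show ?thesis by simp
  qed
  have body: "coeff (?x a) {} = 0" if "a \<in> V <+> E" for a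
    using that edge finA by (auto simp: coeff_hyperedge_elem_empty)
  \<comment> \<open>The monomial of \<open>V\<close> has exactly 2 |V| generators, the largest size
    for which the truncated series is exact by \<open>gexp_sum_square_zero\<close>.\<close>
  have "berezin V (gexp V (coeff (\<Sum>a\<in>V <+> E. ?x a))) = coeff (\<Prod>a\<in>V <+> E. 1 + ?x a) ?S"
    unfolding berezin_def
    by (rule gexp_sum_square_zero) (use finV finE sq body in \<open>auto simp: card_cartesian_product\<close>)
  \<comment> \<open>The vertex factor \<open>1 + const (t i) * bilin i i\<close> is the element of
    the singleton \<open>{i}\<close>, so vertices and hyperedges obey one multiplication
    rule.\<close>
  also have "(\<Prod>a\<in>V <+> E. 1 + ?x a) = ?T * (\<Prod>A\<in>E. const (w A) * hyperedge_elem A (c A) + 1)"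
    by (simp add: prod.Plus[OF finV finE] o_def hyperedge_elem_singleton add.commute)
  also have "\<dots> = (\<Sum>F\<in>Pow E. ?T * (\<Prod>A\<in>F. const (w A) * hyperedge_elem A (c A)))"
    by (simp add: prod_add[OF finE] sum_distrib_left)
  also have "\<dots> = (\<Sum>F\<in>Pow E. const (\<Prod>A\<in>F. w A) * (?T * (\<Prod>A\<in>F. hyperedge_elem A (c A))))"
    by (simp add: prod.distrib const_prod mult_ac)
  also have "coeff \<dots> ?S = (\<Sum>F\<in>Pow E. (\<Prod>A\<in>F. w A) * coeff (?T * (\<Prod>A\<in>F. hyperedge_elem A (c A))) ?S)"
    by simp
  also have "\<dots> = (\<Sum>F\<in>Pow E. if hyperforest F
      then (\<Prod>A\<in>F. w A) * (\<Prod>C\<in>components V F. comp_weight t c F C) else 0)"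
  proof (rule sum.cong[OF refl])
    fix F assume "F \<in> Pow E"
    then have F: "F \<subseteq> E" by simp
    have "?T * (\<Prod>A\<in>F. hyperedge_elem A (c A)) =
        (if hyperforest F then \<Prod>C\<in>components V F. hyperedge_elem C (comp_weight t c F C) else 0)"
      by (rule prod_hyperedge_elem_forest[OF finV finF[OF F]]) (use edge F in fastforce)
    \<comment> \<open>The components partition \<open>V\<close>, so the top monomial of their
      product is the one that the integral extracts.\<close>
    moreover have "coeff (\<Prod>C\<in>components V F. hyperedge_elem C (comp_weight t c F C)) (\<Union>(components V F) \<times> UNIV) =
        (\<Prod>C\<in>components V F. comp_weight t c F C)"
    proof (rule coeff_prod_hyperedge_elem)
      fix C assume "C \<in> components V F"
      then show "finite C \<and> C \<noteq> {}"
        using components_subset[of C V F] components_nonempty[of C V F] finV finite_subset by blast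
    qed (use finV finite_components components_disjoint in blast)+
    ultimately show "(\<Prod>A\<in>F. w A) * coeff (?T * (\<Prod>A\<in>F. hyperedge_elem A (c A))) ?S =
        (if hyperforest F then (\<Prod>A\<in>F. w A) * (\<Prod>C\<in>components V F. comp_weight t c F C) else 0)"
      by (simp add: Union_components)
  qed
  also have "\<dots> = (\<Sum>F\<in>spanning_hyperforests E. (\<Prod>A\<in>F. w A) * (\<Prod>C\<in>components V F. comp_weight t c F C))"
    using finE by (intro sum.mono_neutral_cong_right) (auto simp: spanning_hyperforests_def)
  finally show ?thesis unfolding expo c_def .
qed

theorem theorem5p4:
  fixes V :: "'v::linorder set" and E :: "'v set set"
    and w lam :: "'v set \<Rightarrow> complex" and t :: "'v \<Rightarrow> complex"
  assumes "hypergraph V E"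
  shows "(berezin V (gexp V (gadd (gsum (\<lambda>i. gscale (t i) (gmul (psibar i) (psi i))) V)
                                 (gsum (\<lambda>A. gscale (w A) (fA (lam A) A)) E)))
         = (\<Sum>F\<in>spanning_hyperforests E. (\<Prod>A\<in>F. w A) *
              (\<Prod>C\<in>components V F. (\<Sum>i\<in>C. t i)
                  - (\<Sum>A\<in>comp_edges F C. (of_nat (card A) - 1) * lam A))))
      \<and> (\<forall>l::complex. berezin V (gexp V (gadd (gsum (\<lambda>i. gscale (t i) (gmul (psibar i) (psi i))) V)
                                 (gsum (\<lambda>A. gscale (w A) (fA l A)) E)))
         = (\<Sum>F\<in>spanning_hyperforests E. (\<Prod>A\<in>F. w A) *
              (\<Prod>C\<in>components V F. l + (\<Sum>i\<in>C. t i - l))))"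
proof (intro conjI allI)
  have "comp_weight t (\<lambda>A. lam A * (1 - of_nat (card A))) F C =
      (\<Sum>i\<in>C. t i) - (\<Sum>A\<in>comp_edges F C. (of_nat (card A) - 1) * lam A)" for F C
    by (simp add: comp_weight_def algebra_simps sum_subtractf)
  then show "berezin V (gexp V (gadd (gsum (\<lambda>i. gscale (t i) (gmul (psibar i) (psi i))) V)
        (gsum (\<lambda>A. gscale (w A) (fA (lam A) A)) E)))
      = (\<Sum>F\<in>spanning_hyperforests E. (\<Prod>A\<in>F. w A) *
          (\<Prod>C\<in>components V F. (\<Sum>i\<in>C. t i) - (\<Sum>A\<in>comp_edges F C. (of_nat (card A) - 1) * lam A)))"
    unfolding berezin_gexp_hypergraph[OF assms] by simp
next
  fix l :: complex
  have "comp_weight t (\<lambda>A. l * (1 - of_nat (card A))) F C = l + (\<Sum>i\<in>C. t i - l)"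
    if F: "F \<in> spanning_hyperforests E" and C: "C \<in> components V F" for F C
  proof -
    have "finite V" and edge: "\<And>A. A \<in> F \<Longrightarrow> A \<subseteq> V \<and> A \<noteq> {}"
      using assms F by (force simp: hypergraph_def spanning_hyperforests_def)+
    have "finite F"
      by (rule finite_subset[of _ "Pow V"]) (use edge \<open>finite V\<close> in auto)
    \<comment> \<open>This is where acyclicity enters: the count of vertices against hyperedges in a
      hypertree turns l times the sum of 1 - |A| into l (1 - |C|).\<close>
    have "of_nat (card C) + (\<Sum>A\<in>comp_edges F C. 1 - of_nat (card A)) = (1 :: complex)"
      using hyperforest_comp_weight[OF \<open>finite V\<close> \<open>finite F\<close> edge _ C] F
      by (simp add: comp_weight_def spanning_hyperforests_def)
    then have "(\<Sum>A\<in>comp_edges F C. 1 - of_nat (card A)) = 1 - (of_nat (card C) :: complex)"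
      by (simp add: algebra_simps)
    then have "comp_weight t (\<lambda>A. l * (1 - of_nat (card A))) F C = (\<Sum>i\<in>C. t i) + l * (1 - of_nat (card C))"
      by (simp add: comp_weight_def flip: sum_distrib_left)
    then show ?thesis by (simp add: sum_subtractf algebra_simps)
  qed
  then show "berezin V (gexp V (gadd (gsum (\<lambda>i. gscale (t i) (gmul (psibar i) (psi i))) V)
        (gsum (\<lambda>A. gscale (w A) (fA l A)) E)))
      = (\<Sum>F\<in>spanning_hyperforests E. (\<Prod>A\<in>F. w A) * (\<Prod>C\<in>components V F. l + (\<Sum>i\<in>C. t i - l)))"
    unfolding berezin_gexp_hypergraph[OF assms] by (intro sum.cong prod.cong refl arg_cong2[of _ _ _ _ times]) auto
qed

end
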